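(* Let $\widetilde k=\widetilde k_1\circ\pi_1+\widetilde k_2\circ\pi_2$, with $\widetilde k_1\in L_2^{(0)}(P_0)$ and $\widetilde k_2\in L_2^{(0)}(Q_0)$, be the canonical gradient at $P_0\otimes Q_0$ of a functional $k:\mathcal P\otimes\mathcal Q\to\mathbb R$ differentiable at $P_0\otimes Q_0$, and let $g_1\in L_2^{(0)}(P_0)$, $g_2\in L_2^{(0)}(Q_0)$ be the tangents of $L_2$-differentiable curves $\vartheta\mapsto P_\vartheta$ through $P_0$ and $\vartheta\mapsto Q_\vartheta$ through $Q_0$. Let $(n_1)_n,(n_2)_n\subset\mathbb N$ with $n_1+n_2=n$ and $\lim_{n\to\infty}\frac{n_2}n=d\in(0,1)$. Let $((c_{n,i})_{1\le i\le n})_{n\in\mathbb N}$ and $((\widetilde c_{n,i})_{1\le i\le n})_{n\in\mathbb N}$ be triangular arrays of real numbers with $\max_{i\le n}|c_{n,i}|\to0$, $\max_{i\le n}|\widetilde c_{n,i}|\to0$, $\sum_{i=1}^nc_{n,i}^2\to c_1^2>0$, $\sum_{i=1}^n\widetilde c_{n,i}^2\to c_2^2>0$, and suppose that the limits $$\lim_{n\to\infty}n^{-1/2}\sum_{i=1}^nc_{n,i}=a_1,\qquad \lim_{n\to\infty}n^{-1/2}\sum_{i=1}^n\widetilde c_{n,i}=a_2$$ exist. Define on $\Omega_1^{n_1}\times\Omega_2^{n_2}$, with coordinate projections $\pi_1,\dots,\pi_n$, $$T_n=\frac{\sqrt n}{n_1}\sum_{i=1}^{n_1}\widetilde k_1\circ\pi_i+\frac{\sqrt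 n}{n_2}\sum_{j=1}^{n_2}\widetilde k_2\circ\pi_{n_1+j},\qquad X_n=\sum_{i=1}^{n_1}c_{n_1,i}\,g_1\circ\pi_i+\sum_{j=1}^{n_2}\widetilde c_{n_2,j}\,g_2\circ\pi_{n_1+j}.$$ Then, as $n\to\infty$, weakly, $$\mathcal L\bigl((T_n,X_n)^t\mid P_0^{n_1}\otimes Q_0^{n_2}\bigr)\to N\left(\begin{pmatrix}0\\0\end{pmatrix},\begin{pmatrix}\sigma_1^2&\sigma_{12}\\\sigma_{12}&\sigma_2^2\end{pmatrix}\right)$$ with $$\sigma_1^2=\frac1{1-d}\int\widetilde k_1^2\,dP_0+\frac1d\int\widetilde k_2^2\,dQ_0,\qquad \sigma_2^2=c_1^2\int g_1^2\,dP_0+c_2^2\int g_2^2\,dQ_0,$$ $$\sigma_{12}=a_1\frac1{\sqrt{1-d}}\int\widetilde k_1g_1\,dP_0+a_2\frac1{\sqrt d}\int\widetilde k_2g_2\,dQ_0.$$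
   Context: $\mathcal P,\mathcal Q$ are nonempty families of probability measures on $(\Omega_1,\mathcal A_1)$, $(\Omega_2,\mathcal A_2)$; $\mathcal P\otimes\mathcal Q=\{P\otimes Q:P\in\mathcal P,Q\in\mathcal Q\}$. $L_2^{(0)}(P)=\{h\in L_2(P):\int h\,dP=0\}$. With $dP/dQ$ the density quotient (a $[0,\infty]$-valued measurable $L$ with $P(A)=\int_AL\,dQ+P(A\cap\{L=\infty\})$, $Q(L<\infty)=1$), a curve $t\mapsto R_t$, $|t|<\varepsilon$, is $L_2(R_0)$-differentiable with tangent $g\in L_2(R_0)$ if $\|2((dR_t/dR_0)^{1/2}-1)-tg\|_{L_2(R_0)}=o(|t|)$ and $R_t(dR_t/dR_0=\infty)=o(t^2)$ as $t\to0$; then $g\in L_2^{(0)}(R_0)$. A functional $k$ on a family $\mathcal R$ is differentiable at $R$ with gradient $\dot k\in L_2^{(0)}(R)$ if $\lim_{t\downarrow0}t^{-1}(k(R_t)-k(R))=\int\dot kg\,dR$ for each $L_2$-differentiable curve in $\mathcal R$ with $R_0=R$ and tangent $g$; the canonical gradient is the unique gradient in the tangent space $T(R,\mathcal R)$, the $L_2(R)$-closure of the linear span of all such tangents. At a product measure $P_0\otimes Q_0$ the canonical gradient decomposes uniquely as $\widetilde k(\omega_1,\omega_2)=\widetilde k_1(\omega_1)+\widetilde k_2(\omega_2)$ with $\widetilde k_1\in L_2^{(0)}(P_0)$, $\widetilde k_2\in L_2^{(0)}(Q_0)$. $N(\mu,\Sigma)$ may be degenerate. *)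

theory Defs
  imports "HOL-Probability.Probability" "HOL-Library.Landau_Symbols"
begin

text \<open>Elements of $L_2$ are represented by measurable square-integrable functions; nothing below
  depends on the choice of representatives.\<close>

definition L2 :: "'a measure \<Rightarrow> ('a \<Rightarrow> real) set" where
  "L2 M = {h \<in> borel_measurable M. integrable M (\<lambda>x. (h x)\<^sup>2)}"

definition L2_norm :: "'a measure \<Rightarrow> ('a \<Rightarrow> real) \<Rightarrow> real" where
  "L2_norm M h = sqrt (\<integral>x. (h x)\<^sup>2 \<partial>M)"

definition L2_centered :: "'a measure \<Rightarrow> ('a \<Rightarrow> real) set" where
  "L2_centered M = {h \<in> L2 M. (\<integral>x. h x \<partial>M) = 0}"

definition density_quotient :: "'a measure \<Rightarrow> 'a measure \<Rightarrow> ('a \<Rightarrow> ennreal) \<Rightarrow> bool" where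
  "density_quotient P Q L \<longleftrightarrow>
     L \<in> borel_measurable Q \<and>
     (\<forall>A\<in>sets Q. emeasure P A =
        (\<integral>\<^sup>+x\<in>A. L x \<partial>Q) + emeasure P (A \<inter> {x \<in> space Q. L x = \<infinity>})) \<and>
     emeasure Q {x \<in> space Q. L x < \<infinity>} = 1"

text \<open>Only the values of the curve on $(-\varepsilon,\varepsilon)$ matter. The density quotient is
  unique up to null sets of the sum of the two measures, so the choice of $L$ is immaterial, and
  so is the value of \<^term>\<open>enn2real\<close> at infinity, which is attained by \<^term>\<open>L t\<close> on a null set of
  \<^term>\<open>R 0\<close> only.\<close>

definition L2_differentiable_curve ::
  "real \<Rightarrow> (real \<Rightarrow> 'a measure) \<Rightarrow> ('a \<Rightarrow> real) \<Rightarrow> bool" where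
  "L2_differentiable_curve \<epsilon> R g \<longleftrightarrow>
     0 < \<epsilon> \<and> g \<in> L2 (R 0) \<and>
     (\<exists>L. (\<forall>t. \<bar>t\<bar> < \<epsilon> \<longrightarrow> density_quotient (R t) (R 0) (L t)) \<and>
          (\<lambda>t. L2_norm (R 0) (\<lambda>x. 2 * (sqrt (enn2real (L t x)) - 1) - t * g x)) \<in> o[at 0](\<lambda>t. \<bar>t\<bar>) \<and>
          (\<lambda>t. measure (R t) {x \<in> space (R 0). L t x = \<infinity>}) \<in> o[at 0](\<lambda>t. t\<^sup>2))"

definition L2_curve_in ::
  "'a measure set \<Rightarrow> 'a measure \<Rightarrow> real \<Rightarrow> (real \<Rightarrow> 'a measure) \<Rightarrow> ('a \<Rightarrow> real) \<Rightarrow> bool" where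
  "L2_curve_in \<R> R0 \<epsilon> R g \<longleftrightarrow>
     R 0 = R0 \<and> (\<forall>t. \<bar>t\<bar> < \<epsilon> \<longrightarrow> R t \<in> \<R>) \<and> L2_differentiable_curve \<epsilon> R g"

definition tangents :: "'a measure set \<Rightarrow> 'a measure \<Rightarrow> ('a \<Rightarrow> real) set" where
  "tangents \<R> R0 = {g. \<exists>\<epsilon> R. L2_curve_in \<R> R0 \<epsilon> R g}"

definition fun_span :: "('a \<Rightarrow> real) set \<Rightarrow> ('a \<Rightarrow> real) set" where
  "fun_span T = {(\<lambda>x. \<Sum>g\<in>F. r g * g x) | F r. finite F \<and> F \<subseteq> T}"

definition tangent_space :: "'a measure set \<Rightarrow> 'a measure \<Rightarrow> ('a \<Rightarrow> real) set" where
  "tangent_space \<R> R0 =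
     {h \<in> L2 R0. \<forall>e>0. \<exists>s\<in>fun_span (tangents \<R> R0). L2_norm R0 (\<lambda>x. h x - s x) < e}"

definition is_gradient ::
  "'a measure set \<Rightarrow> ('a measure \<Rightarrow> real) \<Rightarrow> 'a measure \<Rightarrow> ('a \<Rightarrow> real) \<Rightarrow> bool" where
  "is_gradient \<R> k R0 k' \<longleftrightarrow>
     k' \<in> L2_centered R0 \<and>
     (\<forall>\<epsilon> R g. L2_curve_in \<R> R0 \<epsilon> R g \<longrightarrow>
        ((\<lambda>t. (k (R t) - k R0) / t) \<longlongrightarrow> (\<integral>x. k' x * g x \<partial>R0)) (at_right 0))"

definition differentiable_functional ::
  "'a measure set \<Rightarrow> ('a measure \<Rightarrow> real) \<Rightarrow> 'a measure \<Rightarrow> bool" where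
  "differentiable_functional \<R> k R0 \<longleftrightarrow> (\<exists>k'. is_gradient \<R> k R0 k')"

definition is_canonical_gradient ::
  "'a measure set \<Rightarrow> ('a measure \<Rightarrow> real) \<Rightarrow> 'a measure \<Rightarrow> ('a \<Rightarrow> real) \<Rightarrow> bool" where
  "is_canonical_gradient \<R> k R0 k' \<longleftrightarrow> is_gradient \<R> k R0 k' \<and> k' \<in> tangent_space \<R> R0"

definition product_family :: "'a measure set \<Rightarrow> 'b measure set \<Rightarrow> ('a \<times> 'b) measure set" where
  "product_family \<P> \<Q> = {P \<Otimes>\<^sub>M Q | P Q. P \<in> \<P> \<and> Q \<in> \<Q>}"

definition std_mv_normal :: "(real ^ 'n::finite) measure" where
  "std_mv_normal = density lborel (\<lambda>x. \<Prod>i\<in>UNIV. ennreal (std_normal_density (x $ i)))"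

text \<open>The normal distribution with mean \<open>\<mu>\<close> and symmetric positive semidefinite, possibly
  singular, covariance matrix \<open>\<Sigma>\<close> is the law of \<open>\<mu> + A Z\<close>, where \<open>Z\<close> is standard
  normal and \<open>A\<close> is any matrix with \<open>A A\<^sup>T = \<Sigma>\<close>; such an \<open>A\<close> exists, and the law does not
  depend on its choice.\<close>

definition mv_normal :: "real ^ 'n::finite \<Rightarrow> real ^ 'n ^ 'n \<Rightarrow> (real ^ 'n) measure" where
  "mv_normal \<mu> \<Sigma> =
     distr std_mv_normal borel (\<lambda>z. \<mu> + (SOME A :: real ^ 'n ^ 'n. A ** transpose A = \<Sigma>) *v z)"

text \<open>The library notion \<^const>\<open>weak_conv_m\<close> is restricted to the real line.\<close>

definition weakly_converges ::
  "(nat \<Rightarrow> 'a::topological_space measure) \<Rightarrow> 'a measure \<Rightarrow> bool" where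
  "weakly_converges \<mu> \<nu> \<longleftrightarrow>
     (\<forall>f :: 'a \<Rightarrow> real. continuous_on UNIV f \<and> bounded (range f) \<longrightarrow>
        (\<lambda>n. \<integral>x. f x \<partial>\<mu> n) \<longlonglongrightarrow> (\<integral>x. f x \<partial>\<nu>))"

end

theory Submission
  imports Defs
begin

text \<open>For \<open>u = (s, t)\<close> the characteristic function of \<open>(T\<^sub>n, X\<^sub>n)\<close> at \<open>u\<close> is a product over the
  independent observations, each factor being the characteristic function of a small combination
  \<open>\<alpha> k\<^sub>1 + \<beta> g\<^sub>1\<close> or \<open>\<alpha> k\<^sub>2 + \<beta> g\<^sub>2\<close>. A second-order expansion shows that the product tends to
  \<open>exp (- V / 2)\<close>, where \<open>V\<close> is the limit of the variances. In particular \<open>V\<close>, a quadratic form in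
  \<open>u\<close>, is nonnegative, so the limiting matrix is a covariance matrix. Weak convergence follows from
  a multivariate version of Levy's continuity theorem: tightness comes from the one-dimensional
  theorem applied to the coordinates, and on compact sets continuous functions are uniform limits
  of trigonometric sums by Stone--Weierstrass.\<close>

section \<open>Levy's continuity theorem in Euclidean spaces\<close>

text \<open>The phase \<open>b\<close> makes cosines suffice as generators: sines are shifted
  cosines and constants have frequency 0, so no separate sine terms are needed for closure under
  products.\<close>

inductive_set trig_sums :: "('a::euclidean_space \<Rightarrow> real) set" where
  cos: "(\<lambda>x. r * cos (u \<bullet> x + b)) \<in> trig_sums"
| add: "f \<in> trig_sums \<Longrightarrow> g \<in> trig_sums \<Longrightarrow> (\<lambda>x. f x + g x) \<in> trig_sums"

lemma trig_sums_const: "(\<lambda>x. c) \<in> trig_sums"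
  using trig_sums.cos[of c 0 0] by simp

text \<open>For two generators this is the product-to-sum formula for cosines; the general case
  follows by distributivity, with an induction on each factor.\<close>

lemma trig_sums_mult:
  assumes "f \<in> trig_sums" "g \<in> trig_sums"
  shows "(\<lambda>x. f x * g x) \<in> trig_sums"
  using assms(1)
proof induction
  case (cos r u b)
  from assms(2) show ?case
  proof induction
    case (cos s v c)
    have "(\<lambda>x. r * cos (u \<bullet> x + b) * (s * cos (v \<bullet> x + c))) =
        (\<lambda>x. (r * s / 2) * cos ((u - v) \<bullet> x + (b - c)) + (r * s / 2) * cos ((u + v) \<bullet> x + (b + c)))"
    proof
      fix x
      have "(u - v) \<bullet> x + (b - c) = (u \<bullet> x + b) - (v \<bullet> x + c)"
        "(u + v) \<bullet> x + (b + c) = (u \<bullet> x + b) + (v \<bullet> x + c)"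
        by (auto simp: inner_simps)
      then show "r * cos (u \<bullet> x + b) * (s * cos (v \<bullet> x + c)) =
        (r * s / 2) * cos ((u - v) \<bullet> x + (b - c)) + (r * s / 2) * cos ((u + v) \<bullet> x + (b + c))"
        by (simp only: cos_diff cos_add) (simp add: algebra_simps)
    qed
    then show ?case
      by (simp only:) (intro trig_sums.intros)
  next
    case (add f g)
    then show ?case
      using trig_sums.add[OF add.IH] by (simp add: distrib_left)
  qed
next
  case (add f g)
  then show ?case
    using trig_sums.add[OF add.IH] by (simp add: distrib_right)
qed

lemma trig_sums_continuous: "f \<in> trig_sums \<Longrightarrow> continuous_on S f"
  by (induction rule: trig_sums.induct) (auto intro!: continuous_intros)

lemma trig_sums_bounded: "f \<in> trig_sums \<Longrightarrow> \<exists>B. \<forall>x. \<bar>f x\<bar> \<le> B"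
proof (induction rule: trig_sums.induct)
  case (cos r u b)
  show ?case
    by (rule exI[of _ "\<bar>r\<bar>"]) (auto simp: abs_mult intro!: mult_left_le)
next
  case (add f g)
  then obtain B C where "\<And>x. \<bar>f x\<bar> \<le> B" "\<And>x. \<bar>g x\<bar> \<le> C" by blast
  then have "\<bar>f x + g x\<bar> \<le> B + C" for x
    by (meson abs_triangle_ineq add_mono order_trans)
  then show ?case by blast
qed

lemma trig_sums_polynomial:
  assumes "real_polynomial_function p" "f \<in> trig_sums"
  shows "(\<lambda>x. p (f x)) \<in> trig_sums"
  using assms(1)
proof induction
  case (linear h)
  then obtain c where "h = (\<lambda>x. x * c)" using real_bounded_linear by auto
  then show ?case
    using trig_sums_mult[OF assms(2) trig_sums_const] by simp
qed (auto intro: trig_sums_const trig_sums.add trig_sums_mult)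

lemma trig_sums_separating:
  assumes "x \<noteq> y"
  shows "\<exists>f\<in>trig_sums. f x \<noteq> f y"
proof -
  \<comment> \<open>The frequency is scaled so that the phases at \<open>x\<close> and
    \<open>y\<close> differ by pi. With the phase shifted to 0 at \<open>y\<close>, the cosine is 1
    at \<open>y\<close> and -1 at \<open>x\<close>.\<close>
  define u where "u = (pi / (norm (x - y))\<^sup>2) *\<^sub>R (x - y)"
  have "u \<bullet> x + (- (u \<bullet> y)) = u \<bullet> (x - y)" by (simp add: inner_diff_right)
  also have "\<dots> = pi" using assms by (simp add: u_def dot_square_norm)
  finally have "(1::real) * cos (u \<bullet> x + (- (u \<bullet> y))) \<noteq> 1 * cos (u \<bullet> y + (- (u \<bullet> y)))"
    by simp
  then show ?thesis
    by (rule bexI[OF _ trig_sums.cos])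
qed

text \<open>A trigonometric sum that is close to \<open>f\<close> on \<open>K\<close> may be large elsewhere; composing it with a
  polynomial that approximates the truncation at \<open>\<plusminus>B\<close> makes it globally bounded.\<close>

lemma trig_sums_approximation:
  fixes f :: "'a::euclidean_space \<Rightarrow> real"
  assumes K: "compact K" and f: "continuous_on K f" and B: "\<And>x. x \<in> K \<Longrightarrow> \<bar>f x\<bar> \<le> B" "0 \<le> B" and e: "0 < e"
  shows "\<exists>g\<in>trig_sums. (\<forall>x\<in>K. \<bar>f x - g x\<bar> < e) \<and> (\<forall>x. \<bar>g x\<bar> \<le> B + e)"
proof -
  interpret function_ring_on "trig_sums :: ('a \<Rightarrow> real) set" K
    using K trig_sums_continuous trig_sums.add trig_sums_mult trig_sums_const trig_sums_separating
    by unfold_locales auto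
  from Stone_Weierstrass_basic[OF f, of "e/2"] e
  obtain h where h: "h \<in> trig_sums" "\<And>x. x \<in> K \<Longrightarrow> \<bar>f x - h x\<bar> < e/2" by auto
  from trig_sums_bounded[OF h(1)] obtain C where C: "\<And>x. \<bar>h x\<bar> \<le> C" by blast
  define tr where "tr = (\<lambda>y. max (-B) (min B y))"
  \<comment> \<open>The interval contains the whole range of \<open>h\<close>, not only the image of
    \<open>K\<close>, so the polynomial is close to the truncation at \<open>h x\<close> for every
    \<open>x\<close>. This is what gives the global bound.\<close>
  have "continuous_on {-C..C} tr" unfolding tr_def by (intro continuous_intros)
  from Stone_Weierstrass_real_polynomial_function[OF compact_Icc this, of "e/2"] e
  obtain p where p: "real_polynomial_function p" "\<And>y. y \<in> {-C..C} \<Longrightarrow> \<bar>tr y - p y\<bar> < e/2"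
    by auto
  have hC: "h x \<in> {-C..C}" for x using C[of x] by (auto simp: abs_le_iff)
  have "\<bar>f x - p (h x)\<bar> < e" if "x \<in> K" for x
  proof -
    \<comment> \<open>Truncation is the nearest-point projection onto \<open>{-B..B}\<close>. Since
      \<open>f x\<close> lies in this interval, truncating \<open>h x\<close> cannot move it away
      from \<open>f x\<close>.\<close>
    have "\<bar>f x - tr (h x)\<bar> \<le> \<bar>f x - h x\<bar>"
      using B(1)[OF that] by (auto simp: tr_def max_def min_def)
    then show ?thesis using h(2)[OF that] p(2)[OF hC[of x]] by linarith
  qed
  moreover have "\<bar>p (h x)\<bar> \<le> B + e" for x
  proof -
    have "\<bar>tr (h x)\<bar> \<le> B" using B(2) by (auto simp: tr_def)
    then show ?thesis using p(2)[OF hC[of x]] e by linarith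
  qed
  ultimately show ?thesis
    by (intro bexI[OF _ trig_sums_polynomial[OF p(1) h(1)]]) auto
qed

section \<open>From characteristic functions to integrals of trigonometric sums\<close>

lemma integrable_iexp_inner:
  fixes \<mu> :: "'a::euclidean_space measure"
  assumes "prob_space \<mu>" "sets \<mu> = sets borel"
  shows "integrable \<mu> (\<lambda>x. iexp (u \<bullet> x))"
proof -
  note assms(2)[measurable_cong]
  show ?thesis
    by (rule prob_space.integrable_iexp[OF assms(1)]) auto
qed

text \<open>The integral of a generator is the real part of a constant multiple of the
  characteristic function at \<open>u\<close>; sums follow by linearity.\<close>

lemma integral_trig_sums_tendsto:
  fixes \<mu> :: "nat \<Rightarrow> 'a::euclidean_space measure"
  assumes \<mu>: "\<And>n. prob_space (\<mu> n)" "\<And>n. sets (\<mu> n) = sets borel"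
    and \<nu>: "prob_space \<nu>" "sets \<nu> = sets borel"
    and conv: "\<And>u. (\<lambda>n. CLINT x|\<mu> n. iexp (u \<bullet> x)) \<longlonglongrightarrow> (CLINT x|\<nu>. iexp (u \<bullet> x))"
    and f: "f \<in> trig_sums"
  shows "(\<lambda>n. \<integral>x. f x \<partial>\<mu> n) \<longlonglongrightarrow> (\<integral>x. f x \<partial>\<nu>)"
proof -
  have cos_eq: "(\<integral>x. r * cos (u \<bullet> x + b) \<partial>\<rho>) = Re (of_real r * iexp b * (CLINT x|\<rho>. iexp (u \<bullet> x)))"
    and cos_int: "integrable \<rho> (\<lambda>x. r * cos (u \<bullet> x + b))"
    if \<rho>: "prob_space \<rho>" "sets \<rho> = sets borel" for \<rho> and r b :: real and u :: 'a
  proof -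
    have eq: "r * cos (u \<bullet> x + b) = Re (of_real r * iexp b * iexp (u \<bullet> x))" for x
      by (simp add: exp_Euler cos_add cos_of_real sin_of_real algebra_simps)
    note int = integrable_iexp_inner[OF \<rho>, of u]
    show "integrable \<rho> (\<lambda>x. r * cos (u \<bullet> x + b))"
      unfolding eq by (intro integrable_Re integrable_mult_right int)
    show "(\<integral>x. r * cos (u \<bullet> x + b) \<partial>\<rho>) = Re (of_real r * iexp b * (CLINT x|\<rho>. iexp (u \<bullet> x)))"
      unfolding eq using int by (subst integral_Re) auto
  qed
  \<comment> \<open>Integrability is carried through the induction because additivity of the
    integral requires it in the sum case.\<close>
  have "(\<lambda>n. \<integral>x. f x \<partial>\<mu> n) \<longlonglongrightarrow> (\<integral>x. f x \<partial>\<nu>) \<and> (\<forall>n. integrable (\<mu> n) f) \<and> integrable \<nu> f"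
    using f
  proof induction
    case (cos r u b)
    show ?case
      unfolding cos_eq[OF \<nu>] cos_eq[OF \<mu>]
      using cos_int[OF \<mu>] cos_int[OF \<nu>] by (auto intro!: tendsto_intros conv)
  next
    case (add f g)
    then show ?case by (auto intro!: tendsto_add)
  qed
  then show ?thesis by blast
qed

section \<open>Tightness from one-dimensional projections\<close>

lemma real_distribution_inner:
  fixes \<mu> :: "'a::euclidean_space measure"
  assumes "prob_space \<mu>" "sets \<mu> = sets borel"
  shows "real_distribution (distr \<mu> borel (\<lambda>x. x \<bullet> b))"
proof -
  note assms(2)[measurable_cong]
  interpret prob_space \<mu> by fact
  show ?thesis by (intro real_distribution_distr) simp
qed

lemma char_distr_inner:
  fixes \<mu> :: "'a::euclidean_space measure"
  assumes "sets \<mu> = sets borel"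
  shows "char (distr \<mu> borel (\<lambda>x. x \<bullet> b)) t = (CLINT x|\<mu>. iexp ((t *\<^sub>R b) \<bullet> x))"
proof -
  note assms[measurable_cong]
  show ?thesis
    unfolding char_def by (subst integral_distr) (auto simp: inner_commute)
qed

text \<open>Each projection onto a basis vector converges weakly by the one-dimensional theorem, and
  a union bound over the basis controls the complement of a cube. All \<open>R \<ge> r\<close> are
  covered so that radii obtained for different sequences can later be merged.\<close>

lemma tight_if_char_convergent:
  fixes \<mu> :: "nat \<Rightarrow> 'a::euclidean_space measure"
  assumes \<mu>: "\<And>n. prob_space (\<mu> n)" "\<And>n. sets (\<mu> n) = sets borel"
    and \<nu>: "prob_space \<nu>" "sets \<nu> = sets borel"
    and conv: "\<And>u. (\<lambda>n. CLINT x|\<mu> n. iexp (u \<bullet> x)) \<longlonglongrightarrow> (CLINT x|\<nu>. iexp (u \<bullet> x))"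
    and e: "0 < e"
  shows "\<exists>r. \<forall>R\<ge>r. \<forall>\<^sub>F n in sequentially. measure (\<mu> n) (- cbox (- (R *\<^sub>R One)) (R *\<^sub>R One)) \<le> e"
proof -
  note \<mu>(2)[measurable_cong] \<nu>(2)[measurable_cong]
  have space_\<mu>: "space (\<mu> n) = UNIV" for n using sets_eq_imp_space_eq[OF \<mu>(2)[of n]] by simp
  define e' where "e' = e / DIM('a)"
  have e': "e' > 0" unfolding e'_def using e by simp
  \<comment> \<open>A continuous substitute for the indicator of an interval, since weak convergence
    only tests continuous functions: it is 1 for \<open>\<bar>x\<bar> \<le> R\<close> and 0 for
    \<open>\<bar>x\<bar> \<ge> R + 1\<close>.\<close>
  define cut where "cut R x = max 0 (min 1 (R + 1 - \<bar>x\<bar>))" for R x :: real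
  have cut: "0 \<le> cut R x" "cut R x \<le> 1" "cut R x \<noteq> 0 \<Longrightarrow> \<bar>x\<bar> \<le> R + 1" for R x
    unfolding cut_def by (auto simp: max_def min_def split: if_splits)
  have cut_cont: "isCont (cut R) x" for R x
    unfolding cut_def by (intro continuous_intros)
  have cut_meas[measurable]: "cut R \<in> borel_measurable borel" for R
    unfolding cut_def by measurable
  have "\<exists>r. \<forall>\<^sub>F n in sequentially. measure (\<mu> n) {x. \<bar>x \<bullet> b\<bar> > r} \<le> e'" for b :: 'a
  proof -
    let ?m = "\<lambda>n. distr (\<mu> n) borel (\<lambda>x. x \<bullet> b)" and ?l = "distr \<nu> borel (\<lambda>x. x \<bullet> b)"
    interpret l: real_distribution ?l by (rule real_distribution_inner[OF \<nu>])
    have m: "real_distribution (?m n)" for n by (rule real_distribution_inner[OF \<mu>])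
    have wc: "weak_conv_m ?m ?l"
      by (rule levy_continuity[OF m l.real_distribution_axioms])
         (simp only: char_distr_inner \<mu> \<nu> conv)
    \<comment> \<open>As the cutoffs increase to 1, some level \<open>k\<close> captures more than
      \<open>1 - e'\<close> of the limit law; weak convergence passes this to \<open>?m n\<close>
      for large \<open>n\<close>.\<close>
    have "(\<lambda>k. \<integral>x. cut (real k) x \<partial>?l) \<longlonglongrightarrow> (\<integral>x. 1 \<partial>?l)"
    proof (rule integral_dominated_convergence[where w="\<lambda>_. 1"])
      show "AE x in ?l. (\<lambda>k. cut (real k) x) \<longlonglongrightarrow> 1"
      proof (intro AE_I2)
        fix x :: real
        obtain N where "\<bar>x\<bar> \<le> real N" using real_arch_simple by blast
        then have "cut (real k) x = 1" if "k \<ge> N" for k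
          using that by (auto simp: cut_def)
        then show "(\<lambda>k. cut (real k) x) \<longlonglongrightarrow> 1"
          by (intro tendsto_eventually eventually_sequentiallyI)
      qed
    qed (use cut in auto)
    then have "(\<lambda>k. \<integral>x. cut (real k) x \<partial>?l) \<longlonglongrightarrow> 1" using l.prob_space by simp
    from order_tendstoD(1)[OF this, of "1 - e'"] e' obtain k where
      k: "(\<integral>x. cut (real k) x \<partial>?l) > 1 - e'"
      by (auto simp: eventually_sequentially)
    have "(\<lambda>n. \<integral>x. cut (real k) x \<partial>?m n) \<longlonglongrightarrow> (\<integral>x. cut (real k) x \<partial>?l)"
      by (rule weak_conv_imp_integral_bdd_continuous_conv[OF m l.real_distribution_axioms wc, of _ 1])
         (use cut cut_cont in auto)
    from order_tendstoD(1)[OF this k] have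
      "\<forall>\<^sub>F n in sequentially. measure (\<mu> n) {x. \<bar>x \<bullet> b\<bar> > real k + 1} \<le> e'"
    proof eventually_elim
      case (elim n)
      interpret prob_space "\<mu> n" by (rule \<mu>)
      let ?A = "{x. \<bar>x \<bullet> b\<bar> > real k + 1}"
      have A: "?A \<in> sets (\<mu> n)" by simp
      have "(\<integral>x. cut (real k) x \<partial>?m n) = (\<integral>x. cut (real k) (x \<bullet> b) \<partial>\<mu> n)"
        by (subst integral_distr) auto
      \<comment> \<open>The cutoff vanishes on \<open>?A\<close> and is at most 1 elsewhere, so the
        mass of \<open>?A\<close> is at most 1 minus the integral of the cutoff.\<close>
      also have "\<dots> \<le> (\<integral>x. 1 - indicator ?A x \<partial>\<mu> n)"
      proof (rule integral_mono)
        show "integrable (\<mu> n) (\<lambda>x. cut (real k) (x \<bullet> b))"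
          using cut(1,2) by (intro integrable_const_bound[of _ 1]) auto
        show "integrable (\<mu> n) (\<lambda>x. 1 - indicator ?A x :: real)"
          by (intro integrable_const_bound[of _ 1]) (auto split: split_indicator)
        show "cut (real k) (x \<bullet> b) \<le> 1 - indicator ?A x" for x
          using cut(2)[of k "x \<bullet> b"] cut(3)[of k "x \<bullet> b"]
          by (cases "cut (real k) (x \<bullet> b) = 0") (auto split: split_indicator)
      qed
      also have "\<dots> = 1 - measure (\<mu> n) ?A"
      proof -
        have "integrable (\<mu> n) (indicator ?A :: _ \<Rightarrow> real)"
          using A by (rule integrable_real_indicator) (simp add: less_top[symmetric])
        then show ?thesis
          using prob_space space_\<mu>[of n] by (subst Bochner_Integration.integral_diff) (simp_all add: Int_absorb1)
      qed
      finally show ?case using elim by simp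
    qed
    then show ?thesis by blast
  qed
  then obtain r where r: "\<And>b::'a. \<forall>\<^sub>F n in sequentially. measure (\<mu> n) {x. \<bar>x \<bullet> b\<bar> > r b} \<le> e'"
    by metis
  \<comment> \<open>The sum of the \<open>\<bar>r b\<bar>\<close> dominates every single
    \<open>r b\<close>, so one cube serves all coordinates; each coordinate contributes at most
    \<open>e' = e / DIM('a)\<close>.\<close>
  have "\<forall>\<^sub>F n in sequentially. measure (\<mu> n) (- cbox (- (R *\<^sub>R One)) (R *\<^sub>R One)) \<le> e"
    if R: "R \<ge> (\<Sum>b\<in>Basis. \<bar>r b\<bar>)" for R
  proof -
    have "\<forall>\<^sub>F n in sequentially. \<forall>b\<in>Basis. measure (\<mu> n) {x. \<bar>x \<bullet> b\<bar> > r b} \<le> e'"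
      using r by (simp add: eventually_ball_finite_distrib)
    then show ?thesis
    proof eventually_elim
      case (elim n)
      interpret prob_space "\<mu> n" by (rule \<mu>)
      have "- cbox (- (R *\<^sub>R One)) (R *\<^sub>R One) \<subseteq> (\<Union>b\<in>Basis. {x. \<bar>x \<bullet> b\<bar> > r b})"
      proof
        fix x :: 'a assume "x \<in> - cbox (- (R *\<^sub>R One)) (R *\<^sub>R One)"
        then obtain b where b: "b \<in> Basis" "\<bar>x \<bullet> b\<bar> > R" by (auto simp: mem_box)
        have "\<bar>r b\<bar> \<le> (\<Sum>b\<in>Basis. \<bar>r b\<bar>)" using b by (intro member_le_sum) auto
        with b R show "x \<in> (\<Union>b\<in>Basis. {x. \<bar>x \<bullet> b\<bar> > r b})" by force
      qed
      then have "measure (\<mu> n) (- cbox (- (R *\<^sub>R One)) (R *\<^sub>R One)) \<le> measure (\<mu> n) (\<Union>b\<in>Basis. {x. \<bar>x \<bullet> b\<bar> > r b})"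
        by (intro finite_measure_mono) auto
      also have "\<dots> \<le> (\<Sum>b\<in>Basis. measure (\<mu> n) {x. \<bar>x \<bullet> b\<bar> > r b})"
        by (intro finite_measure_subadditive_finite) auto
      also have "\<dots> \<le> (\<Sum>b\<in>(Basis::'a set). e')" using elim by (intro sum_mono) auto
      also have "\<dots> = e" by (simp add: e'_def)
      finally show ?case .
    qed
  qed
  then show ?thesis by blast
qed

theorem levy_continuity_euclidean:
  fixes \<mu> :: "nat \<Rightarrow> 'a::euclidean_space measure"
  assumes \<mu>: "\<And>n. prob_space (\<mu> n)" "\<And>n. sets (\<mu> n) = sets borel"
    and \<nu>: "prob_space \<nu>" "sets \<nu> = sets borel"
    and conv: "\<And>u. (\<lambda>n. CLINT x|\<mu> n. iexp (u \<bullet> x)) \<longlonglongrightarrow> (CLINT x|\<nu>. iexp (u \<bullet> x))"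
  shows "weakly_converges \<mu> \<nu>"
  unfolding weakly_converges_def
proof (intro allI impI, elim conjE)
  fix f :: "'a \<Rightarrow> real"
  assume f: "continuous_on UNIV f" and "bounded (range f)"
  then obtain B where B: "\<And>x. \<bar>f x\<bar> \<le> B" by (auto simp: bounded_iff)
  then have B0: "0 \<le> B" by (meson abs_ge_zero order_trans)
  show "(\<lambda>n. \<integral>x. f x \<partial>\<mu> n) \<longlonglongrightarrow> (\<integral>x. f x \<partial>\<nu>)"
  proof (rule LIMSEQ_I)
    fix e :: real assume e: "e > 0"
    \<comment> \<open>Below, \<open>\<bar>f - g\<bar>\<close> is at most \<open>\<delta>\<close> on
      \<open>K\<close> and at most \<open>2 * B + 1\<close> off \<open>K\<close>, the latter because
      \<open>\<delta> \<le> 1\<close>. As the complement of \<open>K\<close> has mass at most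
      \<open>\<delta>\<close>, the total error is at most
      \<open>\<delta> * (2 * B + 2)\<close>.\<close>
    define \<delta> where "\<delta> = min 1 (e / (4 * (2 * B + 2)))"
    have \<delta>: "0 < \<delta>" "\<delta> \<le> 1" using e B0 by (auto simp: \<delta>_def)
    have \<delta>e: "\<delta> * (2 * B + 2) \<le> e / 4"
    proof -
      have "\<delta> * (2 * B + 2) \<le> e / (4 * (2 * B + 2)) * (2 * B + 2)"
        using B0 by (intro mult_right_mono) (auto simp: \<delta>_def)
      also have "\<dots> = e / 4" using B0 by (simp add: divide_simps)
      finally show ?thesis .
    qed
    obtain r1 where r1: "\<And>R. R \<ge> r1 \<Longrightarrow> \<forall>\<^sub>F n in sequentially. measure (\<mu> n) (- cbox (- (R *\<^sub>R One)) (R *\<^sub>R One)) \<le> \<delta>"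
      using tight_if_char_convergent[OF \<mu> \<nu> conv \<delta>(1)] by blast
    \<comment> \<open>Tightness of the single law \<open>\<nu>\<close> is the case of a constant
      sequence.\<close>
    obtain r2 where r2: "\<And>R. R \<ge> r2 \<Longrightarrow> measure \<nu> (- cbox (- (R *\<^sub>R One)) (R *\<^sub>R One)) \<le> \<delta>"
      using tight_if_char_convergent[of "\<lambda>_. \<nu>" \<nu>, OF \<nu> \<nu> tendsto_const \<delta>(1)] by auto
    define K :: "'a set" where "K = cbox (- (max r1 r2 *\<^sub>R One)) (max r1 r2 *\<^sub>R One)"
    have K: "compact K" "K \<in> sets borel" by (auto simp: K_def)
    obtain g where g: "g \<in> trig_sums" "\<And>x. x \<in> K \<Longrightarrow> \<bar>f x - g x\<bar> < \<delta>" "\<And>x. \<bar>g x\<bar> \<le> B + \<delta>"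
      using trig_sums_approximation[OF K(1) continuous_on_subset[OF f] B B0 \<delta>(1)] by blast
    have diff: "\<bar>(\<integral>x. f x \<partial>\<rho>) - (\<integral>x. g x \<partial>\<rho>)\<bar> \<le> e / 4"
      if \<rho>: "prob_space \<rho>" "sets \<rho> = sets borel" "measure \<rho> (-K) \<le> \<delta>" for \<rho>
    proof -
      interpret prob_space \<rho> by fact
      note \<rho>(2)[measurable_cong]
      have [measurable]: "f \<in> borel_measurable borel" "g \<in> borel_measurable borel"
        using f trig_sums_continuous[OF g(1)] by (auto intro: borel_measurable_continuous_onI)
      have K'[measurable]: "- K \<in> sets \<rho>" using K \<rho> by auto
      have "integrable \<rho> f" using B by (auto intro!: integrable_const_bound[of _ B])
      moreover have "integrable \<rho> g" using g(3) by (auto intro!: integrable_const_bound[of _ "B + \<delta>"])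
      ultimately have int: "integrable \<rho> f" "integrable \<rho> g" .
      have int_K: "integrable \<rho> (indicator (- K) :: _ \<Rightarrow> real)"
        using K' by (rule integrable_real_indicator) (simp add: less_top[symmetric])
      from int have "\<bar>(\<integral>x. f x \<partial>\<rho>) - (\<integral>x. g x \<partial>\<rho>)\<bar> = \<bar>\<integral>x. f x - g x \<partial>\<rho>\<bar>" by simp
      also have "\<dots> \<le> (\<integral>x. \<bar>f x - g x\<bar> \<partial>\<rho>)" by (rule integral_abs_bound)
      also have "\<dots> \<le> (\<integral>x. \<delta> + (2 * B + 1) * indicator (- K) x \<partial>\<rho>)"
      proof (rule integral_mono)
        show "integrable \<rho> (\<lambda>x. \<bar>f x - g x\<bar>)"
          using int by auto
        show "\<bar>f x - g x\<bar> \<le> \<delta> + (2 * B + 1) * indicator (- K) x" for x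
        proof (cases "x \<in> K")
          case True then show ?thesis using g(2)[OF True] by simp
        next
          case False
          then show ?thesis using B[of x] g(3)[of x] \<delta> by simp
        qed
        show "integrable \<rho> (\<lambda>x. \<delta> + (2 * B + 1) * indicator (- K) x)" using int_K by auto
      qed
      also have "\<dots> = \<delta> + (2 * B + 1) * measure \<rho> (- K)"
        by (subst Bochner_Integration.integral_add[OF integrable_const integrable_mult_right[OF int_K]])
           (use K' prob_space sets_eq_imp_space_eq[OF \<rho>(2)] in simp)
      also have "\<dots> \<le> \<delta> + (2 * B + 1) * \<delta>"
        using \<rho>(3) B0 by (intro add_left_mono mult_left_mono) auto
      also have "\<dots> = \<delta> * (2 * B + 2)" by (simp add: algebra_simps)
      finally show ?thesis using \<delta>e by linarith
    qed
    have "\<forall>\<^sub>F n in sequentially. measure (\<mu> n) (- K) \<le> \<delta>"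
      unfolding K_def by (rule r1) simp
    moreover have "\<forall>\<^sub>F n in sequentially. dist (\<integral>x. g x \<partial>\<mu> n) (\<integral>x. g x \<partial>\<nu>) < e / 4"
      using integral_trig_sums_tendsto[OF \<mu> \<nu> conv g(1)] e by (intro tendstoD) auto
    \<comment> \<open>The difference splits into three terms of size at most \<open>e / 4\<close>:
      replacing \<open>f\<close> by \<open>g\<close> under \<open>\<mu> n\<close>, passing to the
      limit for \<open>g\<close>, and replacing \<open>g\<close> by \<open>f\<close> under
      \<open>\<nu>\<close>.\<close>
    ultimately have "\<forall>\<^sub>F n in sequentially. norm ((\<integral>x. f x \<partial>\<mu> n) - (\<integral>x. f x \<partial>\<nu>)) < e"
    proof eventually_elim
      case (elim n)
      have "measure \<nu> (- K) \<le> \<delta>" unfolding K_def by (rule r2) simp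
      from diff[OF \<nu> this] diff[OF \<mu> elim(1)] elim(2) e show ?case
        unfolding dist_real_def real_norm_def by linarith
    qed
    then show "\<exists>N. \<forall>n\<ge>N. norm ((\<integral>x. f x \<partial>\<mu> n) - (\<integral>x. f x \<partial>\<nu>)) < e"
      by (simp add: eventually_sequentially)
  qed
qed

section \<open>Characteristic functions of multivariate normal distributions\<close>

text \<open>Lebesgue measure is the image of the product of one-dimensional Lebesgue measures under
  the coordinate map (\<open>lborel_eq\<close>), so Fubini applies. Values in a normed field are
  allowed in order to cover complex exponentials.\<close>

lemma integral_lborel_prod:
  fixes f :: "'a::euclidean_space \<Rightarrow> real \<Rightarrow> 'b::{real_normed_field,banach,second_countable_topology}"
  assumes "\<And>b. b \<in> Basis \<Longrightarrow> integrable lborel (f b)"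
  shows "(\<integral>x. (\<Prod>b\<in>Basis. f b (x \<bullet> b)) \<partial>lborel) = (\<Prod>b\<in>Basis. \<integral>x. f b x \<partial>lborel)"
proof -
  interpret product_sigma_finite "\<lambda>_::'a. lborel :: real measure" ..
  have [measurable]: "f b \<in> borel_measurable borel" if "b \<in> Basis" for b
    using borel_measurable_integrable[OF assms[OF that]] by simp
  have "(\<integral>x. (\<Prod>b\<in>Basis. f b (x \<bullet> b)) \<partial>lborel) =
      (\<integral>y. (\<Prod>b\<in>Basis. f b ((\<Sum>b\<in>Basis. y b *\<^sub>R b) \<bullet> b)) \<partial>(\<Pi>\<^sub>M b\<in>Basis. lborel))"
    by (subst lborel_eq, subst integral_distr) auto
  also have "\<dots> = (\<integral>y. (\<Prod>b\<in>Basis. f b (y b)) \<partial>(\<Pi>\<^sub>M b\<in>Basis. lborel))"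
    by simp
  also have "\<dots> = (\<Prod>b\<in>Basis. \<integral>x. f b x \<partial>lborel)"
    by (rule product_integral_prod) (use assms in auto)
  finally show ?thesis .
qed

text \<open>Translates products over \<open>Basis\<close>, in which Lebesgue integrals factor, into
  the products over indices used by \<open>std_mv_normal\<close>.\<close>

lemma prod_Basis_vec:
  fixes h :: "real^'n::finite \<Rightarrow> 'b::comm_monoid_mult"
  shows "(\<Prod>b\<in>(Basis :: (real^'n) set). h b) = (\<Prod>i\<in>UNIV. h (axis i 1))"
proof -
  have "(Basis :: (real^'n) set) = (\<lambda>i. axis i 1) ` UNIV"
    by (auto simp: Basis_vec_def)
  moreover have "inj (\<lambda>i::'n. axis i (1::real))" by (auto simp: inj_on_def axis_eq_axis)
  ultimately show ?thesis by (intro prod.reindex_cong[where l="\<lambda>i. axis i 1"]) auto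
qed

section \<open>The standard normal distribution\<close>

lemma prob_space_std_mv_normal: "prob_space (std_mv_normal :: (real^'n::finite) measure)"
proof
  have "(\<Prod>i\<in>UNIV. ennreal (std_normal_density (x $ i))) = (\<Prod>b\<in>Basis. ennreal (std_normal_density (x \<bullet> b)))"
    for x :: "real^'n" unfolding prod_Basis_vec by (simp add: inner_axis)
  moreover have "(\<integral>\<^sup>+x. ennreal (std_normal_density x) \<partial>lborel) = 1"
    using prob_space.emeasure_space_1[OF prob_space_normal_density[of 1 0]]
    by (simp add: emeasure_density)
  ultimately show "emeasure (std_mv_normal :: (real^'n) measure) (space std_mv_normal) = 1"
    unfolding std_mv_normal_def
    by (simp add: emeasure_density nn_integral_lborel_prod[where f="\<lambda>_ x. ennreal (std_normal_density x)"])
qed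

lemma sets_std_mv_normal [measurable_cong, simp]: "sets std_mv_normal = sets borel"
  by (simp add: std_mv_normal_def)

text \<open>Density and exponential both factor over the coordinates, which leaves a product of
  one-dimensional standard normal characteristic functions.\<close>

lemma std_mv_normal_characteristic_function:
  "(CLINT x|(std_mv_normal :: (real^'n::finite) measure). iexp (u \<bullet> x)) = exp (- (u \<bullet> u) / 2)"
proof -
  have eq: "(\<Prod>i\<in>UNIV. std_normal_density (x $ i)) *\<^sub>R iexp (u \<bullet> x) =
     (\<Prod>b\<in>Basis. std_normal_density (x \<bullet> b) *\<^sub>R iexp ((u \<bullet> b) * (x \<bullet> b)))" for x :: "real^'n"
    unfolding prod_Basis_vec
    by (simp add: inner_axis scaleR_conv_of_real prod.distrib exp_sum[symmetric] sum_distrib_left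
          inner_vec_def[of u x] mult.assoc)
  have int: "integrable lborel (\<lambda>y. std_normal_density y *\<^sub>R iexp (t * y))" for t
    using prob_space.integrable_iexp[OF prob_space_normal_density[of 1 0], of "\<lambda>y. of_real (t * y)"]
    by (simp add: integrable_density)
  have char: "(CLINT y|lborel. std_normal_density y *\<^sub>R iexp (t * y)) = exp (- t\<^sup>2 / 2)" for t
  proof -
    have "char std_normal_distribution t = (CLINT y|lborel. std_normal_density y *\<^sub>R iexp (t * y))"
      unfolding char_def by (subst integral_density) auto
    then show ?thesis by (simp add: char_std_normal_distribution)
  qed
  have "(CLINT x|(std_mv_normal :: (real^'n::finite) measure). iexp (u \<bullet> x)) =
    (CLINT x|lborel. (\<Prod>i\<in>UNIV. std_normal_density (x $ i)) *\<^sub>R iexp (u \<bullet> x))"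
    unfolding std_mv_normal_def
    by (simp add: prod_ennreal, subst integral_density) (auto intro!: prod_nonneg)
  also have "\<dots> = (\<Prod>b\<in>Basis. exp (- (u \<bullet> b)\<^sup>2 / 2))"
    unfolding eq by (subst integral_lborel_prod[OF int]) (simp only: char of_real_prod)
  also have "\<dots> = exp (- (u \<bullet> u) / 2)"
    by (simp add: exp_sum[symmetric] sum_negf sum_divide_distrib[symmetric] euclidean_inner[of u u] power2_eq_square
      flip: of_real_prod of_real_exp)
  finally show ?thesis .
qed

section \<open>Normal distributions with possibly singular covariance\<close>

lemma prob_space_mv_normal: "prob_space (mv_normal \<mu> \<Sigma>)"
  unfolding mv_normal_def
  by (intro prob_space.prob_space_distr prob_space_std_mv_normal)
     (auto simp: measurable_cong_sets[OF sets_std_mv_normal refl]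
           intro!: borel_measurable_continuous_onI continuous_intros)

lemma sets_mv_normal [measurable_cong, simp]: "sets (mv_normal \<mu> \<Sigma>) = sets borel"
  by (simp add: mv_normal_def)

text \<open>Moving \<open>A\<close> across the inner product gives the standard normal
  characteristic function at \<open>transpose A *v u\<close>, whose squared norm is the quadratic
  form of \<open>\<Sigma>\<close>. The choice of \<open>A\<close> thus disappears; the hypothesis
  ensures that \<open>SOME\<close> picks a genuine root.\<close>

lemma mv_normal_characteristic_function:
  fixes \<Sigma> :: "real^'n::finite^'n"
  assumes "\<exists>A :: real^'n^'n. A ** transpose A = \<Sigma>"
  shows "(CLINT x|mv_normal \<mu> \<Sigma>. iexp (u \<bullet> x)) = iexp (u \<bullet> \<mu>) * exp (- (u \<bullet> (\<Sigma> *v u)) / 2)"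
proof -
  define A where "A = (SOME A :: real^'n^'n. A ** transpose A = \<Sigma>)"
  have A: "A ** transpose A = \<Sigma>" unfolding A_def by (rule someI_ex[OF assms])
  have [measurable]: "(\<lambda>z. \<mu> + A *v z) \<in> borel_measurable borel"
    by (auto intro!: borel_measurable_continuous_onI continuous_intros)
  have "(CLINT x|mv_normal \<mu> \<Sigma>. iexp (u \<bullet> x)) = (CLINT z|std_mv_normal. iexp (u \<bullet> (\<mu> + A *v z)))"
    unfolding mv_normal_def A_def[symmetric] by (subst integral_distr) auto
  also have "\<dots> = (CLINT z|std_mv_normal. iexp (u \<bullet> \<mu>) * iexp ((transpose A *v u) \<bullet> z))"
    by (simp add: inner_add_right dot_lmul_matrix[symmetric] distrib_left exp_add)
  also have "\<dots> = iexp (u \<bullet> \<mu>) * exp (- ((transpose A *v u) \<bullet> (transpose A *v u)) / 2)"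
    by (simp add: std_mv_normal_characteristic_function)
  also have "(transpose A *v u) \<bullet> (transpose A *v u) = u \<bullet> (\<Sigma> *v u)"
    by (simp add: A[symmetric] matrix_vector_mul_assoc[symmetric] dot_lmul_matrix[symmetric])
  finally show ?thesis .
qed

text \<open>The root is the lower triangular Cholesky factor. If \<open>p = 0\<close>,
  semidefiniteness forces \<open>q = 0\<close> and only the corner entry \<open>sqrt r\<close>
  remains.\<close>

lemma exists_matrix_sqrt_2:
  fixes p q r :: real
  assumes psd: "\<And>s t. 0 \<le> s\<^sup>2 * p + 2 * s * t * q + t\<^sup>2 * r"
  shows "\<exists>A :: real^2^2. A ** transpose A = vector [vector [p, q], vector [q, r]]"
proof -
  have p: "0 \<le> p" and r: "0 \<le> r" using psd[of 1 0] psd[of 0 1] by auto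
  have prod: "(vector [vector [a, b], vector [c, d]] :: real^2^2) ** transpose (vector [vector [a, b], vector [c, d]])
     = (vector [vector [a\<^sup>2 + b\<^sup>2, a * c + b * d], vector [a * c + b * d, c\<^sup>2 + d\<^sup>2]] :: real^2^2)" for a b c d :: real
    by (simp add: vec_eq_iff forall_2 matrix_matrix_mult_def sum_2 transpose_def power2_eq_square)
  show ?thesis
  proof (cases "p = 0")
    case True
    have "q = 0"
    proof (rule ccontr)
      assume "q \<noteq> 0"
      \<comment> \<open>For \<open>p = 0\<close> and \<open>t = 1\<close> the form is
        \<open>2 * s * q + r\<close>; this \<open>s\<close> gives it the value -1.\<close>
      with psd[of "- (r + 1) / (2 * q)" 1] True show False by (simp add: divide_simps split: if_splits)
    qed
    then have "(vector [vector [0, 0], vector [0, sqrt r]] :: real^2^2) ** transpose (vector [vector [0, 0], vector [0, sqrt r]])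
       = (vector [vector [p, q], vector [q, r]] :: real^2^2)"
      unfolding prod using True r by simp
    then show ?thesis by blast
  next
    case False
    with p have p: "0 < p" by simp
    \<comment> \<open>At \<open>(-q, p)\<close> the form equals \<open>p\<close> times the
      determinant.\<close>
    have "0 \<le> p * (p * r - q\<^sup>2)" using psd[of "-q" p] by (simp add: power2_eq_square algebra_simps)
    then have "0 \<le> p * r - q\<^sup>2" using p by (simp add: zero_le_mult_iff)
    then have nn: "0 \<le> r - q\<^sup>2 / p" using p by (simp add: field_simps)
    have "(vector [vector [sqrt p, 0], vector [q / sqrt p, sqrt (r - q\<^sup>2 / p)]] :: real^2^2) **
       transpose (vector [vector [sqrt p, 0], vector [q / sqrt p, sqrt (r - q\<^sup>2 / p)]])
       = (vector [vector [p, q], vector [q, r]] :: real^2^2)"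
      unfolding prod using p nn by (simp add: power_divide)
    then show ?thesis by blast
  qed
qed

section \<open>Characteristic functions of weighted sums\<close>

text \<open>This is \<open>char_approx3'\<close> for the law of \<open>Y\<close> at argument 1. The
  minimum of a quadratic and a cubic remainder is integrable with second moments alone, yet of
  smaller order than the variance when \<open>Y\<close> is small.\<close>

lemma (in prob_space) iexp_moment_approximation:
  fixes Y :: "'a \<Rightarrow> real"
  assumes [measurable]: "Y \<in> borel_measurable M" and Y2: "integrable M (\<lambda>x. (Y x)\<^sup>2)" and "expectation Y = 0"
  shows "cmod ((CLINT x|M. iexp (Y x)) - (1 - expectation (\<lambda>x. (Y x)\<^sup>2) / 2))
     \<le> expectation (\<lambda>x. min (6 * (Y x)\<^sup>2) (\<bar>Y x\<bar> ^ 3)) / 6"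
proof -
  have "integrable M Y" by (rule square_integrable_imp_integrable[OF _ Y2]) simp
  from char_approx3'[OF assms(1) this Y2 assms(3) refl refl, of 1] show ?thesis
    by (simp add: char_def integral_distr assms(3))
qed

text \<open>The upper estimate comes from \<open>(1 - v + v^2) * (1 + v) = 1 + v^3 \<ge> 1\<close>
  and \<open>1 + v \<le> exp v\<close>.\<close>

lemma exp_minus_linear_bound:
  fixes v :: real
  assumes "0 \<le> v"
  shows "\<bar>exp (- v) - (1 - v)\<bar> \<le> v\<^sup>2"
proof -
  have "1 - v \<le> exp (- v)" using exp_ge_add_one_self[of "- v"] by simp
  moreover have "exp (- v) \<le> 1 - v + v\<^sup>2"
  proof -
    have "1 \<le> 1 + v ^ 3" using assms by simp
    also have "\<dots> = (1 - v + v\<^sup>2) * (1 + v)" by (simp add: power2_eq_square power3_eq_cube algebra_simps)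
    also have "\<dots> \<le> (1 - v + v\<^sup>2) * exp v"
    proof (rule mult_left_mono)
      have "1 - v + v\<^sup>2 = (1 - v / 2)\<^sup>2 + 3 / 4 * v\<^sup>2" by (simp add: power2_eq_square algebra_simps)
      then show "0 \<le> 1 - v + v\<^sup>2" by simp
    qed simp
    finally show ?thesis by (simp add: exp_minus field_simps)
  qed
  ultimately show ?thesis by simp
qed

text \<open>The pointwise domination of the squares by multiples of one integrable function replaces the
  Lindeberg condition.\<close>

lemma (in prob_space) prod_iexp_tendsto_gaussian:
  fixes Y :: "nat \<Rightarrow> 'i \<Rightarrow> 'a \<Rightarrow> real" and w :: "nat \<Rightarrow> 'i \<Rightarrow> real"
  assumes Y_meas[measurable]: "\<And>n i. Y n i \<in> borel_measurable M"
    and Y_mean: "\<And>n i. expectation (Y n i) = 0"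
    and q: "integrable M q"
    and dom: "\<And>n i x. (Y n i x)\<^sup>2 \<le> w n i * q x"
    and w_nonneg: "\<And>n i. 0 \<le> w n i"
    and w_max: "\<And>n i. i \<in> I n \<Longrightarrow> w n i \<le> (\<delta> n)\<^sup>2" "\<And>n. 0 \<le> \<delta> n" "\<delta> \<longlonglongrightarrow> 0"
    and w_sum: "(\<lambda>n. \<Sum>i\<in>I n. w n i) \<longlonglongrightarrow> W"
    and var: "(\<lambda>n. \<Sum>i\<in>I n. expectation (\<lambda>x. (Y n i x)\<^sup>2)) \<longlonglongrightarrow> V"
  shows "(\<lambda>n. \<Prod>i\<in>I n. CLINT x|M. iexp (Y n i x)) \<longlonglongrightarrow> exp (- V / 2)"
proof -
  have [measurable]: "q \<in> borel_measurable M" using q by auto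
  \<comment> \<open>If the weights vanish, \<open>dom\<close> does not determine the sign of
    \<open>q\<close>. The positive part still dominates and is nonnegative, as the estimates below
    require.\<close>
  define Q where "Q x = max 0 (q x)" for x
  have [measurable]: "Q \<in> borel_measurable M" unfolding Q_def by measurable
  have Q: "integrable M Q" unfolding Q_def using q by auto
  have Q0: "0 \<le> Q x" for x by (simp add: Q_def)
  have dom_Q: "(Y n i x)\<^sup>2 \<le> w n i * Q x" for n i x
    using dom[of n i x] mult_left_mono[OF _ w_nonneg, of "q x" "Q x" n i] by (simp add: Q_def)
  have Y2: "integrable M (\<lambda>x. (Y n i x)\<^sup>2)" for n i
    by (rule Bochner_Integration.integrable_bound[where f="\<lambda>x. w n i * Q x"])
       (use Q dom_Q w_nonneg Q0 in auto)
  define v where "v n i = expectation (\<lambda>x. (Y n i x)\<^sup>2)" for n i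
  have v0: "0 \<le> v n i" for n i by (simp add: v_def)
  have v_le: "v n i \<le> w n i * expectation Q" for n i
  proof -
    have "v n i \<le> expectation (\<lambda>x. w n i * Q x)"
      unfolding v_def using Y2 Q dom_Q by (intro integral_mono) auto
    then show ?thesis by simp
  qed
  \<comment> \<open>Bounds the Taylor remainder per unit of weight. It tends to 0 by dominated
    convergence with majorant \<open>6 * Q\<close>, because \<open>\<delta>\<close> tends to
    0.\<close>
  define L where "L n = expectation (\<lambda>x. Q x * min 6 (\<delta> n * sqrt (Q x)))" for n
  have int_L: "integrable M (\<lambda>x. Q x * min 6 (\<delta> n * sqrt (Q x)))" for n
    by (rule Bochner_Integration.integrable_bound[where f="\<lambda>x. 6 * Q x"])
       (use Q Q0 w_max(2)[of n] in \<open>auto intro!: AE_I2 simp: abs_mult mult.commute mult_left_mono\<close>)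
  have L0: "L \<longlonglongrightarrow> 0"
  proof -
    have "L \<longlonglongrightarrow> expectation (\<lambda>x. 0)"
      unfolding L_def
    proof (rule integral_dominated_convergence[where w="\<lambda>x. 6 * Q x"])
      show "AE x in M. (\<lambda>n. Q x * min 6 (\<delta> n * sqrt (Q x))) \<longlonglongrightarrow> 0"
      proof (intro AE_I2)
        fix x
        have "(\<lambda>n. Q x * min 6 (\<delta> n * sqrt (Q x))) \<longlonglongrightarrow> Q x * min 6 (0 * sqrt (Q x))"
          by (intro tendsto_intros w_max(3))
        then show "(\<lambda>n. Q x * min 6 (\<delta> n * sqrt (Q x))) \<longlonglongrightarrow> 0" by simp
      qed
      show "AE x in M. norm (Q x * min 6 (\<delta> n * sqrt (Q x))) \<le> 6 * Q x" for n
        using Q0 w_max(2)[of n] by (auto intro!: AE_I2 simp: abs_mult mult.commute mult_left_mono)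
    qed (use Q in auto)
    then show ?thesis by simp
  qed
  have third: "min (6 * (Y n i x)\<^sup>2) (\<bar>Y n i x\<bar> ^ 3) \<le> w n i * (Q x * min 6 (\<delta> n * sqrt (Q x)))"
    if i: "i \<in> I n" for n i x
  proof -
    have "\<bar>Y n i x\<bar> = sqrt ((Y n i x)\<^sup>2)" by simp
    also have "\<dots> \<le> sqrt ((\<delta> n)\<^sup>2 * Q x)"
      using dom_Q[of n i x] mult_right_mono[OF w_max(1)[OF i] Q0, of x] by (intro real_sqrt_le_mono) linarith
    also have "\<dots> = \<delta> n * sqrt (Q x)" using w_max(2) by (simp add: real_sqrt_mult)
    finally have le: "\<bar>Y n i x\<bar> \<le> \<delta> n * sqrt (Q x)" .
    have "min (6 * (Y n i x)\<^sup>2) (\<bar>Y n i x\<bar> ^ 3) = (Y n i x)\<^sup>2 * min 6 \<bar>Y n i x\<bar>"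
      by (simp add: mult_min_right power3_eq_cube power2_eq_square mult.commute)
    also have "\<dots> \<le> (w n i * Q x) * min 6 (\<delta> n * sqrt (Q x))"
      using dom_Q[of n i x] le w_nonneg Q0 by (intro mult_mono) auto
    finally show ?thesis by (simp add: mult.assoc)
  qed
  define \<phi> where "\<phi> n i = (CLINT x|M. iexp (Y n i x))" for n i
  have \<phi>_norm: "cmod (\<phi> n i) \<le> 1" for n i
  proof -
    have "cmod (\<phi> n i) \<le> expectation (\<lambda>x. cmod (iexp (Y n i x)))"
      unfolding \<phi>_def by (rule integral_norm_bound)
    then show ?thesis by (simp add: prob_space)
  qed
  \<comment> \<open>The first term is the Taylor remainder, the second the cost of replacing
    \<open>1 - v / 2\<close> by an exponential. Both are proportional to \<open>w n i\<close>, so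
    summation leaves the convergent total weight times a factor tending to 0.\<close>
  have step: "cmod (\<phi> n i - exp (- v n i / 2)) \<le> w n i * (L n / 6 + (\<delta> n)\<^sup>2 * (expectation Q)\<^sup>2 / 4)"
    if i: "i \<in> I n" for n i
  proof -
    have int3: "integrable M (\<lambda>x. min (6 * (Y n i x)\<^sup>2) (\<bar>Y n i x\<bar> ^ 3))"
      by (rule Bochner_Integration.integrable_bound[where f="\<lambda>x. 6 * (Y n i x)\<^sup>2"]) (use Y2 in auto)
    have "cmod (\<phi> n i - complex_of_real (1 - v n i / 2)) \<le> expectation (\<lambda>x. min (6 * (Y n i x)\<^sup>2) (\<bar>Y n i x\<bar> ^ 3)) / 6"
      using iexp_moment_approximation[OF Y_meas Y2 Y_mean] by (simp add: \<phi>_def v_def)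
    also have "\<dots> \<le> expectation (\<lambda>x. w n i * (Q x * min 6 (\<delta> n * sqrt (Q x)))) / 6"
      by (intro divide_right_mono integral_mono int3 integrable_mult_right int_L third i) simp
    also have "\<dots> = w n i * (L n / 6)" by (simp add: L_def)
    finally have 1: "cmod (\<phi> n i - complex_of_real (1 - v n i / 2)) \<le> w n i * (L n / 6)" .
    have "cmod (complex_of_real (1 - v n i / 2) - complex_of_real (exp (- v n i / 2))) = \<bar>exp (- (v n i / 2)) - (1 - v n i / 2)\<bar>"
      unfolding of_real_diff[symmetric] norm_of_real by (simp add: abs_minus_commute)
    also have "\<dots> \<le> (v n i / 2)\<^sup>2" using v0 by (intro exp_minus_linear_bound) simp
    also have "\<dots> = v n i * v n i / 4" by (simp add: power2_eq_square)
    also have "\<dots> \<le> (w n i * expectation Q) * ((\<delta> n)\<^sup>2 * expectation Q) / 4"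
    proof (intro divide_right_mono mult_mono)
      show "v n i \<le> (\<delta> n)\<^sup>2 * expectation Q"
        using v_le[of n i] mult_right_mono[OF w_max(1)[OF i], of "expectation Q"] Q0 by (simp add: order_trans)
    qed (use v_le v0 w_nonneg Q0 in auto)
    also have "\<dots> = w n i * ((\<delta> n)\<^sup>2 * (expectation Q)\<^sup>2 / 4)" by (simp add: power2_eq_square)
    finally have 2: "cmod (complex_of_real (1 - v n i / 2) - complex_of_real (exp (- v n i / 2))) \<le> w n i * ((\<delta> n)\<^sup>2 * (expectation Q)\<^sup>2 / 4)" .
    from norm_diff_triangle_le[OF 1 2] show ?thesis by (simp add: distrib_left)
  qed
  have "(\<lambda>n. (\<Prod>i\<in>I n. \<phi> n i) - (\<Prod>i\<in>I n. complex_of_real (exp (- v n i / 2)))) \<longlonglongrightarrow> 0"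
  proof (rule Lim_null_comparison)
    show "\<forall>\<^sub>F n in sequentially. norm ((\<Prod>i\<in>I n. \<phi> n i) - (\<Prod>i\<in>I n. complex_of_real (exp (- v n i / 2))))
       \<le> (\<Sum>i\<in>I n. w n i) * (L n / 6 + (\<delta> n)\<^sup>2 * (expectation Q)\<^sup>2 / 4)"
    proof (intro always_eventually allI)
      fix n
      \<comment> \<open>The difference of two products of numbers in the closed unit disc is at most
        the sum of the differences of the factors.\<close>
      have "norm ((\<Prod>i\<in>I n. \<phi> n i) - (\<Prod>i\<in>I n. complex_of_real (exp (- v n i / 2))))
        \<le> (\<Sum>i\<in>I n. cmod (\<phi> n i - exp (- v n i / 2)))"
        using \<phi>_norm v0 by (intro norm_prod_diff) auto
      also have "\<dots> \<le> (\<Sum>i\<in>I n. w n i * (L n / 6 + (\<delta> n)\<^sup>2 * (expectation Q)\<^sup>2 / 4))"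
        by (intro sum_mono step)
      finally show "norm ((\<Prod>i\<in>I n. \<phi> n i) - (\<Prod>i\<in>I n. complex_of_real (exp (- v n i / 2))))
       \<le> (\<Sum>i\<in>I n. w n i) * (L n / 6 + (\<delta> n)\<^sup>2 * (expectation Q)\<^sup>2 / 4)"
        by (simp add: sum_distrib_right)
    qed
    have "(\<lambda>n. (\<Sum>i\<in>I n. w n i) * (L n / 6 + (\<delta> n)\<^sup>2 * (expectation Q)\<^sup>2 / 4))
       \<longlonglongrightarrow> W * (0 / 6 + 0\<^sup>2 * (expectation Q)\<^sup>2 / 4)"
      by (intro tendsto_intros w_sum L0 w_max(3)) auto
    then show "(\<lambda>n. (\<Sum>i\<in>I n. w n i) * (L n / 6 + (\<delta> n)\<^sup>2 * (expectation Q)\<^sup>2 / 4)) \<longlonglongrightarrow> 0"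
      by simp
  qed
  moreover have "(\<lambda>n. \<Prod>i\<in>I n. complex_of_real (exp (- v n i / 2))) \<longlonglongrightarrow> exp (- V / 2)"
  proof -
    have exp_eq: "exp (- (\<Sum>i\<in>I n. v n i) / 2) = (\<Prod>i\<in>I n. exp (- v n i / 2))" for n
    \<comment> \<open>For infinite \<open>I n\<close> the sum is 0 and the product is 1 by
      convention, so the identity persists.\<close>
    proof (cases "finite (I n)")
      case True
      then show ?thesis by (simp add: exp_sum[symmetric] sum_negf sum_divide_distrib)
    qed simp
    have "(\<lambda>n. complex_of_real (exp (- (\<Sum>i\<in>I n. v n i) / 2))) \<longlonglongrightarrow> exp (- V / 2)"
      using var unfolding v_def by (intro tendsto_intros) auto
    then show ?thesis unfolding exp_eq by simp
  qed
  ultimately show ?thesis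
    unfolding \<phi>_def by (rule Lim_transform[rotated])
qed

text \<open>By Cauchy-Schwarz in the plane, the squared combination is at most
  \<open>\<alpha>^2 + \<beta>^2\<close> times \<open>h^2 + g^2\<close>, which supplies weights and a
  single dominating function. \<open>V\<close> is nonnegative as a limit of sums of second
  moments.\<close>

lemma (in prob_space) prod_iexp_combination_tendsto:
  fixes h g :: "'a \<Rightarrow> real" and \<alpha> \<beta> :: "nat \<Rightarrow> 'i \<Rightarrow> real"
  assumes h: "h \<in> L2_centered M" and g: "g \<in> L2_centered M"
    and bound: "\<And>n i. i \<in> I n \<Longrightarrow> \<bar>\<alpha> n i\<bar> \<le> \<delta> n" "\<And>n i. i \<in> I n \<Longrightarrow> \<bar>\<beta> n i\<bar> \<le> \<delta>' n"
      "\<delta> \<longlonglongrightarrow> 0" "\<delta>' \<longlonglongrightarrow> 0" "\<And>n. 0 \<le> \<delta> n" "\<And>n. 0 \<le> \<delta>' n"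
    and sums: "(\<lambda>n. \<Sum>i\<in>I n. (\<alpha> n i)\<^sup>2) \<longlonglongrightarrow> A" "(\<lambda>n. \<Sum>i\<in>I n. (\<beta> n i)\<^sup>2) \<longlonglongrightarrow> B"
      "(\<lambda>n. \<Sum>i\<in>I n. \<alpha> n i * \<beta> n i) \<longlonglongrightarrow> C"
  defines "V \<equiv> A * (\<integral>x. (h x)\<^sup>2 \<partial>M) + 2 * C * (\<integral>x. h x * g x \<partial>M) + B * (\<integral>x. (g x)\<^sup>2 \<partial>M)"
  shows "(\<lambda>n. \<Prod>i\<in>I n. CLINT x|M. iexp (\<alpha> n i * h x + \<beta> n i * g x)) \<longlonglongrightarrow> exp (- V / 2)"
    and "0 \<le> V"
proof -
  have [measurable]: "h \<in> borel_measurable M" "g \<in> borel_measurable M"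
    and sq: "integrable M (\<lambda>x. (h x)\<^sup>2)" "integrable M (\<lambda>x. (g x)\<^sup>2)"
    and mean: "expectation h = 0" "expectation g = 0"
    using h g by (auto simp: L2_centered_def L2_def)
  have int: "integrable M h" "integrable M g"
    using sq by (auto intro: square_integrable_imp_integrable)
  have prod: "integrable M (\<lambda>x. h x * g x)"
  proof (rule Bochner_Integration.integrable_bound[where f="\<lambda>x. (h x)\<^sup>2 + (g x)\<^sup>2"])
    show "AE x in M. norm (h x * g x) \<le> norm ((h x)\<^sup>2 + (g x)\<^sup>2)"
    proof (intro AE_I2)
      fix x
      have "2 * \<bar>h x\<bar> * \<bar>g x\<bar> \<le> \<bar>h x\<bar>\<^sup>2 + \<bar>g x\<bar>\<^sup>2" by (rule sum_squares_bound)
      moreover have "0 \<le> \<bar>h x\<bar> * \<bar>g x\<bar>" by simp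
      ultimately have "\<bar>h x\<bar> * \<bar>g x\<bar> \<le> (h x)\<^sup>2 + (g x)\<^sup>2" unfolding power2_abs by linarith
      then show "norm (h x * g x) \<le> norm ((h x)\<^sup>2 + (g x)\<^sup>2)" by (simp add: abs_mult)
    qed
  qed (use sq in auto)
  let ?Y = "\<lambda>n i x. \<alpha> n i * h x + \<beta> n i * g x"
  have "expectation (\<lambda>x. (?Y n i x)\<^sup>2) = (\<alpha> n i)\<^sup>2 * expectation (\<lambda>x. (h x)\<^sup>2)
      + 2 * (\<alpha> n i * \<beta> n i) * expectation (\<lambda>x. h x * g x) + (\<beta> n i)\<^sup>2 * expectation (\<lambda>x. (g x)\<^sup>2)" for n i
  proof -
    have "(?Y n i x)\<^sup>2 = (\<alpha> n i)\<^sup>2 * (h x)\<^sup>2 + 2 * (\<alpha> n i * \<beta> n i) * (h x * g x) + (\<beta> n i)\<^sup>2 * (g x)\<^sup>2" for x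
      by (simp add: power2_eq_square algebra_simps)
    then show ?thesis using sq prod by simp
  qed
  then have sum_var: "(\<Sum>i\<in>I n. expectation (\<lambda>x. (?Y n i x)\<^sup>2)) = (\<Sum>i\<in>I n. (\<alpha> n i)\<^sup>2) * expectation (\<lambda>x. (h x)\<^sup>2)
      + 2 * (\<Sum>i\<in>I n. \<alpha> n i * \<beta> n i) * expectation (\<lambda>x. h x * g x) + (\<Sum>i\<in>I n. (\<beta> n i)\<^sup>2) * expectation (\<lambda>x. (g x)\<^sup>2)" for n
    by (simp add: sum.distrib sum_distrib_right sum_distrib_left)
  have var: "(\<lambda>n. \<Sum>i\<in>I n. expectation (\<lambda>x. (?Y n i x)\<^sup>2)) \<longlonglongrightarrow> V"
    unfolding sum_var V_def by (intro tendsto_intros sums)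
  show "0 \<le> V"
    by (rule LIMSEQ_le_const[OF var]) (auto intro!: sum_nonneg)
  show "(\<lambda>n. \<Prod>i\<in>I n. CLINT x|M. iexp (?Y n i x)) \<longlonglongrightarrow> exp (- V / 2)"
  proof (rule prod_iexp_tendsto_gaussian[where w="\<lambda>n i. (\<alpha> n i)\<^sup>2 + (\<beta> n i)\<^sup>2" and q="\<lambda>x. (h x)\<^sup>2 + (g x)\<^sup>2"
        and \<delta>="\<lambda>n. \<delta> n + \<delta>' n" and W="A + B", OF _ _ _ _ _ _ _ _ _ var])
    show "expectation (?Y n i) = 0" for n i using int mean by simp
    show "(?Y n i x)\<^sup>2 \<le> ((\<alpha> n i)\<^sup>2 + (\<beta> n i)\<^sup>2) * ((h x)\<^sup>2 + (g x)\<^sup>2)" for n i x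
    proof -
      \<comment> \<open>Lagrange's identity: the defect in Cauchy-Schwarz is a square.\<close>
      have "((\<alpha> n i)\<^sup>2 + (\<beta> n i)\<^sup>2) * ((h x)\<^sup>2 + (g x)\<^sup>2) - (?Y n i x)\<^sup>2 = (\<alpha> n i * g x - \<beta> n i * h x)\<^sup>2"
        by (simp add: power2_eq_square algebra_simps)
      then show ?thesis by (metis diff_ge_0_iff_ge zero_le_power2)
    qed
    show "(\<alpha> n i)\<^sup>2 + (\<beta> n i)\<^sup>2 \<le> (\<delta> n + \<delta>' n)\<^sup>2" if "i \<in> I n" for n i
    proof -
      have "(\<alpha> n i)\<^sup>2 \<le> (\<delta> n)\<^sup>2" "(\<beta> n i)\<^sup>2 \<le> (\<delta>' n)\<^sup>2"
        using bound(1,2)[OF that] by (auto simp: abs_le_square_iff[symmetric] bound(5,6))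
      moreover have "0 \<le> \<delta> n * \<delta>' n" using bound(5,6) by simp
      ultimately show ?thesis by (simp add: power2_sum)
    qed
    show "(\<lambda>n. \<delta> n + \<delta>' n) \<longlonglongrightarrow> 0" using tendsto_add[OF bound(3,4)] by simp
    show "(\<lambda>n. \<Sum>i\<in>I n. (\<alpha> n i)\<^sup>2 + (\<beta> n i)\<^sup>2) \<longlonglongrightarrow> A + B"
      using tendsto_add[OF sums(1,2)] by (simp add: sum.distrib)
  qed (use sq bound(5,6) in auto)
qed

section \<open>Factorization for two independent samples\<close>

text \<open>The exponential turns the sum into a product of functions of single coordinates, and
  Fubini is applied first to the pair and then to each finite product. All factors have modulus 1,
  hence are integrable.\<close>

lemma integral_iexp_sum_pair_PiM:
  fixes f :: "nat \<Rightarrow> 'a \<Rightarrow> real" and g :: "nat \<Rightarrow> 'b \<Rightarrow> real"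
  assumes P: "prob_space P" and Q: "prob_space Q" and I: "finite I" and J: "finite J"
    and f[measurable]: "\<And>i. f i \<in> borel_measurable P" and g[measurable]: "\<And>j. g j \<in> borel_measurable Q"
  shows "(CLINT \<omega>|(\<Pi>\<^sub>M i\<in>I. P) \<Otimes>\<^sub>M (\<Pi>\<^sub>M j\<in>J. Q). iexp ((\<Sum>i\<in>I. f i (fst \<omega> i)) + (\<Sum>j\<in>J. g j (snd \<omega> j))))
    = (\<Prod>i\<in>I. CLINT x|P. iexp (f i x)) * (\<Prod>j\<in>J. CLINT y|Q. iexp (g j y))"
proof -
  interpret P: prob_space P by fact
  interpret Q: prob_space Q by fact
  interpret PP: product_prob_space "\<lambda>_::nat. P" I ..
  interpret QQ: product_prob_space "\<lambda>_::nat. Q" J ..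
  let ?P = "\<Pi>\<^sub>M i\<in>I. P" and ?Q = "\<Pi>\<^sub>M j\<in>J. Q"
  interpret PQ: pair_prob_space ?P ?Q ..
  let ?F = "\<lambda>x. \<Prod>i\<in>I. iexp (f i (x i))" and ?G = "\<lambda>y. \<Prod>j\<in>J. iexp (g j (y j))"
  have eq: "iexp ((\<Sum>i\<in>I. f i (fst \<omega> i)) + (\<Sum>j\<in>J. g j (snd \<omega> j))) = ?F (fst \<omega>) * ?G (snd \<omega>)" for \<omega>
    using I J by (simp add: exp_sum[symmetric] sum_distrib_left distrib_left exp_add)
  have int: "integrable (?P \<Otimes>\<^sub>M ?Q) (\<lambda>\<omega>. ?F (fst \<omega>) * ?G (snd \<omega>))"
    by (rule PQ.integrable_const_bound[of _ 1]) (auto simp: norm_mult prod_norm[symmetric])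
  have "(\<integral>\<omega>. ?F (fst \<omega>) * ?G (snd \<omega>) \<partial>(?P \<Otimes>\<^sub>M ?Q)) = (\<integral>x. \<integral>y. ?F x * ?G y \<partial>?Q \<partial>?P)"
    using PQ.integral_fst'[OF int] by simp
  also have "\<dots> = (\<integral>x. ?F x \<partial>?P) * (\<integral>y. ?G y \<partial>?Q)"
    by simp
  also have "(\<integral>x. ?F x \<partial>?P) = (\<Prod>i\<in>I. CLINT x|P. iexp (f i x))"
    by (rule PP.product_integral_prod[OF I]) (auto intro: P.integrable_iexp)
  also have "(\<integral>y. ?G y \<partial>?Q) = (\<Prod>j\<in>J. CLINT y|Q. iexp (g j y))"
    by (rule QQ.product_integral_prod[OF J]) (auto intro: Q.integrable_iexp)
  finally show ?thesis unfolding eq .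
qed

section \<open>The joint limit\<close>

text \<open>Stated for a general limiting proportion \<open>\<rho>\<close>, so that it serves both
  samples, with \<open>1 - d\<close> and \<open>d\<close>. The array is read in row
  \<open>m n\<close>, so its limits are transported along \<open>m\<close>, which tends to infinity
  because \<open>\<rho> > 0\<close>.\<close>

lemma one_sample_characteristic_function_tendsto:
  fixes h g :: "'a \<Rightarrow> real" and c :: "nat \<Rightarrow> nat \<Rightarrow> real" and m :: "nat \<Rightarrow> nat" and s t \<rho> \<gamma> a :: real
  assumes P: "prob_space P" and h: "h \<in> L2_centered P" and g: "g \<in> L2_centered P"
    and m: "(\<lambda>n. real (m n) / real n) \<longlonglongrightarrow> \<rho>" "0 < \<rho>"
    and c_max: "(\<lambda>n. MAX i\<in>{1..n}. \<bar>c n i\<bar>) \<longlonglongrightarrow> 0"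
    and c_sq: "(\<lambda>n. \<Sum>i=1..n. (c n i)\<^sup>2) \<longlonglongrightarrow> \<gamma>"
    and c_sum: "(\<lambda>n. (\<Sum>i=1..n. c n i) / sqrt (real n)) \<longlonglongrightarrow> a"
  defines "V \<equiv> s\<^sup>2 / \<rho> * (\<integral>x. (h x)\<^sup>2 \<partial>P) + 2 * (s * t * a / sqrt \<rho>) * (\<integral>x. h x * g x \<partial>P)
      + t\<^sup>2 * \<gamma> * (\<integral>x. (g x)\<^sup>2 \<partial>P)"
  shows "(\<lambda>n. \<Prod>i=1..m n. CLINT x|P. iexp (s * (sqrt (real n) / real (m n)) * h x + t * c (m n) i * g x))
      \<longlonglongrightarrow> exp (- V / 2)"
    and "0 \<le> V"
proof -
  interpret prob_space P by fact
  have "filterlim (\<lambda>n. real (m n) / real n * real n) at_top sequentially"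
    by (rule filterlim_tendsto_pos_mult_at_top[OF m filterlim_real_sequentially])
  \<comment> \<open>At \<open>n = 0\<close> the quotient is 0 by convention while \<open>m 0\<close>
    is arbitrary, hence only an eventual identity.\<close>
  moreover have "\<forall>\<^sub>F n in sequentially. real (m n) / real n * real n = real (m n)"
    by (intro eventually_sequentiallyI[of 1]) auto
  ultimately have m_real: "filterlim (\<lambda>n. real (m n)) at_top sequentially"
    using filterlim_cong by fast
  then have m_top: "filterlim m sequentially sequentially"
    unfolding filterlim_at_top by (metis (mono_tags, lifting) eventually_mono of_nat_le_iff)
  have ratio: "(\<lambda>n. real n / real (m n)) \<longlonglongrightarrow> 1 / \<rho>"
    using tendsto_inverse[OF m(1)] m(2) by (simp add: inverse_eq_divide)
  then have sqrt_ratio: "(\<lambda>n. sqrt (real n / real (m n))) \<longlonglongrightarrow> 1 / sqrt \<rho>"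
    using tendsto_real_sqrt by (fastforce simp: real_sqrt_divide)
  let ?\<alpha> = "\<lambda>n (i::nat). s * (sqrt (real n) / real (m n))" and ?\<beta> = "\<lambda>n i. t * c (m n) i"
  \<comment> \<open>The first factor converges and the second vanishes, which gives smallness of the
    coefficients. In the mixed sum the second factor is exactly the normalization in
    \<open>c_sum\<close>.\<close>
  have \<alpha>_eq: "sqrt (real n) / real (m n) = sqrt (real n / real (m n)) * inverse (sqrt (real (m n)))" for n
    by (simp add: real_sqrt_divide field_simps)
  \<comment> \<open>The absolute value around the maximum keeps the bound nonnegative when
    \<open>m n = 0\<close>, where the maximum of the empty set is unspecified.\<close>
  let ?\<delta> = "\<lambda>n. \<bar>?\<alpha> n 0\<bar>" and ?\<delta>' = "\<lambda>n. \<bar>t\<bar> * \<bar>MAX i\<in>{1..m n}. \<bar>c (m n) i\<bar>\<bar>"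
  have "filterlim (\<lambda>n. sqrt (real (m n))) at_top sequentially"
    by (rule filterlim_compose[OF sqrt_at_top m_real])
  then have inv: "(\<lambda>n. inverse (sqrt (real (m n)))) \<longlonglongrightarrow> 0"
    by (rule tendsto_inverse_0_at_top)
  have "(\<lambda>n. ?\<alpha> n 0) \<longlonglongrightarrow> s * (1 / sqrt \<rho> * 0)"
    unfolding \<alpha>_eq by (intro tendsto_intros sqrt_ratio inv)
  then have \<delta>: "?\<delta> \<longlonglongrightarrow> 0" by (intro tendsto_rabs_zero) simp
  have "?\<delta>' \<longlonglongrightarrow> \<bar>t\<bar> * \<bar>0\<bar>"
    by (intro tendsto_intros filterlim_compose[OF c_max m_top])
  then have \<delta>': "?\<delta>' \<longlonglongrightarrow> 0" by simp
  have \<beta>_le: "\<bar>?\<beta> n i\<bar> \<le> ?\<delta>' n" if "i \<in> {1..m n}" for n i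
  proof -
    have "\<bar>c (m n) i\<bar> \<le> (MAX i\<in>{1..m n}. \<bar>c (m n) i\<bar>)" using that by (intro Max_ge) auto
    then show ?thesis by (simp add: abs_mult mult_left_mono)
  qed
  have "(\<lambda>n. s\<^sup>2 * (real n / real (m n))) \<longlonglongrightarrow> s\<^sup>2 * (1 / \<rho>)"
    by (intro tendsto_intros ratio)
  moreover have "(\<Sum>i=1..m n. (?\<alpha> n i)\<^sup>2) = s\<^sup>2 * (real n / real (m n))" for n
    by (simp add: power_mult_distrib power_divide power2_eq_square)
  ultimately have sum_\<alpha>: "(\<lambda>n. \<Sum>i=1..m n. (?\<alpha> n i)\<^sup>2) \<longlonglongrightarrow> s\<^sup>2 / \<rho>" by simp
  have "(\<lambda>n. t\<^sup>2 * (\<Sum>i=1..m n. (c (m n) i)\<^sup>2)) \<longlonglongrightarrow> t\<^sup>2 * \<gamma>"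
    by (intro tendsto_intros filterlim_compose[OF c_sq m_top])
  then have sum_\<beta>: "(\<lambda>n. \<Sum>i=1..m n. (?\<beta> n i)\<^sup>2) \<longlonglongrightarrow> t\<^sup>2 * \<gamma>"
    by (simp add: power_mult_distrib sum_distrib_left)
  have "(\<lambda>n. s * t * sqrt (real n / real (m n)) * ((\<Sum>i=1..m n. c (m n) i) / sqrt (real (m n))))
      \<longlonglongrightarrow> s * t * (1 / sqrt \<rho>) * a"
    by (intro tendsto_intros sqrt_ratio filterlim_compose[OF c_sum m_top])
  moreover have "(\<Sum>i=1..m n. ?\<alpha> n i * ?\<beta> n i)
      = s * t * sqrt (real n / real (m n)) * ((\<Sum>i=1..m n. c (m n) i) / sqrt (real (m n)))" for n
    unfolding \<alpha>_eq by (simp add: sum_distrib_left sum_divide_distrib field_simps)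
  ultimately have sum_\<alpha>\<beta>: "(\<lambda>n. \<Sum>i=1..m n. ?\<alpha> n i * ?\<beta> n i) \<longlonglongrightarrow> s * t * a / sqrt \<rho>" by simp
  note * = prod_iexp_combination_tendsto[OF h g _ \<beta>_le \<delta> \<delta>' _ _ sum_\<alpha> sum_\<beta> sum_\<alpha>\<beta>]
  show "(\<lambda>n. \<Prod>i=1..m n. CLINT x|P. iexp (s * (sqrt (real n) / real (m n)) * h x + t * c (m n) i * g x))
      \<longlonglongrightarrow> exp (- V / 2)"
    unfolding V_def by (rule *(1)) auto
  show "0 \<le> V"
    unfolding V_def by (rule *(2)) auto
qed

theorem mainTheorem4:
  fixes M1 :: "'a measure" and M2 :: "'b measure"
    and \<P> :: "'a measure set" and \<Q> :: "'b measure set"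
    and P0 :: "'a measure" and Q0 :: "'b measure"
    and k :: "('a \<times> 'b) measure \<Rightarrow> real"
    and k1 g1 :: "'a \<Rightarrow> real" and k2 g2 :: "'b \<Rightarrow> real"
    and Pcurve :: "real \<Rightarrow> 'a measure" and Qcurve :: "real \<Rightarrow> 'b measure"
    and \<epsilon>1 \<epsilon>2 :: real
    and n1 n2 :: "nat \<Rightarrow> nat"
    and c c' :: "nat \<Rightarrow> nat \<Rightarrow> real"
    and d c1 c2 a1 a2 :: real
    and T X :: "nat \<Rightarrow> (nat \<Rightarrow> 'a) \<times> (nat \<Rightarrow> 'b) \<Rightarrow> real"
  assumes families: "\<P> \<subseteq> space (prob_algebra M1)" "\<Q> \<subseteq> space (prob_algebra M2)"
    and base: "P0 \<in> \<P>" "Q0 \<in> \<Q>"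
    and diff: "differentiable_functional (product_family \<P> \<Q>) k (P0 \<Otimes>\<^sub>M Q0)"
    and canonical: "is_canonical_gradient (product_family \<P> \<Q>) k (P0 \<Otimes>\<^sub>M Q0)
                      (\<lambda>\<omega>. k1 (fst \<omega>) + k2 (snd \<omega>))"
    and k12: "k1 \<in> L2_centered P0" "k2 \<in> L2_centered Q0"
    and g12: "g1 \<in> L2_centered P0" "g2 \<in> L2_centered Q0"
    and Pcurve: "L2_curve_in (space (prob_algebra M1)) P0 \<epsilon>1 Pcurve g1"
    and Qcurve: "L2_curve_in (space (prob_algebra M2)) Q0 \<epsilon>2 Qcurve g2"
    and n12: "\<And>n. n \<ge> 1 \<Longrightarrow> n1 n + n2 n = n"
    and d: "(\<lambda>n. real (n2 n) / real n) \<longlonglongrightarrow> d" "0 < d" "d < 1"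
    and c_max: "(\<lambda>n. MAX i\<in>{1..n}. \<bar>c n i\<bar>) \<longlonglongrightarrow> 0"
               "(\<lambda>n. MAX i\<in>{1..n}. \<bar>c' n i\<bar>) \<longlonglongrightarrow> 0"
    and c_sq: "(\<lambda>n. \<Sum>i=1..n. (c n i)\<^sup>2) \<longlonglongrightarrow> c1\<^sup>2" "c1\<^sup>2 > 0"
              "(\<lambda>n. \<Sum>i=1..n. (c' n i)\<^sup>2) \<longlonglongrightarrow> c2\<^sup>2" "c2\<^sup>2 > 0"
    and a: "(\<lambda>n. (\<Sum>i=1..n. c n i) / sqrt (real n)) \<longlonglongrightarrow> a1"
           "(\<lambda>n. (\<Sum>i=1..n. c' n i) / sqrt (real n)) \<longlonglongrightarrow> a2"
    and T: "\<And>n x y. T n (x, y) =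
              sqrt (real n) / real (n1 n) * (\<Sum>i=1..n1 n. k1 (x i)) +
              sqrt (real n) / real (n2 n) * (\<Sum>j=1..n2 n. k2 (y j))"
    and X: "\<And>n x y. X n (x, y) =
              (\<Sum>i=1..n1 n. c (n1 n) i * g1 (x i)) + (\<Sum>j=1..n2 n. c' (n2 n) j * g2 (y j))"
  shows "weakly_converges
           (\<lambda>n. distr ((\<Pi>\<^sub>M i\<in>{1..n1 n}. P0) \<Otimes>\<^sub>M (\<Pi>\<^sub>M j\<in>{1..n2 n}. Q0)) borel
                  (\<lambda>\<omega>. vector [T n \<omega>, X n \<omega>] :: real ^ 2))
           (let \<sigma>1sq = 1 / (1 - d) * (\<integral>x. (k1 x)\<^sup>2 \<partial>P0) + 1 / d * (\<integral>y. (k2 y)\<^sup>2 \<partial>Q0);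
                \<sigma>2sq = c1\<^sup>2 * (\<integral>x. (g1 x)\<^sup>2 \<partial>P0) + c2\<^sup>2 * (\<integral>y. (g2 y)\<^sup>2 \<partial>Q0);
                \<sigma>12 = a1 * (1 / sqrt (1 - d)) * (\<integral>x. k1 x * g1 x \<partial>P0)
                      + a2 * (1 / sqrt d) * (\<integral>y. k2 y * g2 y \<partial>Q0)
            in mv_normal (vector [0, 0]) (vector [vector [\<sigma>1sq, \<sigma>12], vector [\<sigma>12, \<sigma>2sq]]))"
proof -
  have P0: "prob_space P0" and Q0: "prob_space Q0"
    using families base by (auto simp: space_prob_algebra)
  have [measurable]: "k1 \<in> borel_measurable P0" "g1 \<in> borel_measurable P0"
    "k2 \<in> borel_measurable Q0" "g2 \<in> borel_measurable Q0"
    using k12 g12 by (auto simp: L2_centered_def L2_def)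
  let ?N = "\<lambda>n. (\<Pi>\<^sub>M i\<in>{1..n1 n}. P0) \<Otimes>\<^sub>M (\<Pi>\<^sub>M j\<in>{1..n2 n}. Q0)"
  let ?Z = "\<lambda>n \<omega>. vector [T n \<omega>, X n \<omega>] :: real^2"
  define p where "p = 1 / (1 - d) * (\<integral>x. (k1 x)\<^sup>2 \<partial>P0) + 1 / d * (\<integral>y. (k2 y)\<^sup>2 \<partial>Q0)"
  define r where "r = c1\<^sup>2 * (\<integral>x. (g1 x)\<^sup>2 \<partial>P0) + c2\<^sup>2 * (\<integral>y. (g2 y)\<^sup>2 \<partial>Q0)"
  define q where "q = a1 * (1 / sqrt (1 - d)) * (\<integral>x. k1 x * g1 x \<partial>P0)
      + a2 * (1 / sqrt d) * (\<integral>y. k2 y * g2 y \<partial>Q0)"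
  let ?\<Sigma> = "vector [vector [p, q], vector [q, r]] :: real^2^2"

  have "(\<lambda>n. 1 - real (n2 n) / real n) \<longlonglongrightarrow> 1 - d"
    by (intro tendsto_intros d)
  moreover have "\<forall>\<^sub>F n in sequentially. 1 - real (n2 n) / real n = real (n1 n) / real n"
  proof (rule eventually_sequentiallyI)
    fix n :: nat assume n: "1 \<le> n"
    then have "real n = real (n1 n) + real (n2 n)" using n12 by (metis of_nat_add)
    then show "1 - real (n2 n) / real n = real (n1 n) / real n" using n by (simp add: field_simps)
  qed
  ultimately have n1: "(\<lambda>n. real (n1 n) / real n) \<longlonglongrightarrow> 1 - d"
    by (rule Lim_transform_eventually)
  have d': "0 < 1 - d" using d by simp
  note sample1 = one_sample_characteristic_function_tendsto[OF P0 k12(1) g12(1) n1 d' c_max(1) c_sq(1) a(1)]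
  note sample2 = one_sample_characteristic_function_tendsto[OF Q0 k12(2) g12(2) d(1,2) c_max(2) c_sq(3) a(2)]

  \<comment> \<open>The quadratic form of the limiting matrix is the sum of the limiting variances
    of the two samples, each nonnegative for all \<open>s\<close> and \<open>t\<close>.\<close>
  have "0 \<le> s\<^sup>2 * p + 2 * s * t * q + t\<^sup>2 * r" for s t
    using sample1(2)[of s t] sample2(2)[of s t] by (simp add: p_def q_def r_def algebra_simps)
  then have root: "\<exists>A :: real^2^2. A ** transpose A = ?\<Sigma>" by (rule exists_matrix_sqrt_2)

  have Z_meas[measurable]: "?Z n \<in> borel_measurable (?N n)" for n
  proof -
    have vec: "?Z n \<omega> = T n \<omega> *\<^sub>R axis 1 1 + X n \<omega> *\<^sub>R axis 2 1" for \<omega>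
      by (simp add: vec_eq_iff forall_2 axis_def)
    have T_fun: "T n = (\<lambda>\<omega>. sqrt (real n) / real (n1 n) * (\<Sum>i=1..n1 n. k1 (fst \<omega> i)) +
        sqrt (real n) / real (n2 n) * (\<Sum>j=1..n2 n. k2 (snd \<omega> j)))"
      by (rule ext) (metis T prod.collapse)
    have X_fun: "X n = (\<lambda>\<omega>. (\<Sum>i=1..n1 n. c (n1 n) i * g1 (fst \<omega> i)) +
        (\<Sum>j=1..n2 n. c' (n2 n) j * g2 (snd \<omega> j)))"
      by (rule ext) (metis X prod.collapse)
    have [measurable]: "T n \<in> borel_measurable (?N n)" "X n \<in> borel_measurable (?N n)"
      unfolding T_fun X_fun by measurable
    show ?thesis unfolding vec by measurable
  qed
  have N: "prob_space (?N n)" for n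
    by (intro prob_space_pair prob_space_PiM P0 Q0)

  have "weakly_converges (\<lambda>n. distr (?N n) borel (?Z n)) (mv_normal (vector [0, 0]) ?\<Sigma>)"
  proof (rule levy_continuity_euclidean)
    show "prob_space (distr (?N n) borel (?Z n))" for n
      by (rule prob_space.prob_space_distr[OF N Z_meas])
    fix u :: "real^2"
    define s t where "s = u $ 1" and "t = u $ 2"
    have "(CLINT x|distr (?N n) borel (?Z n). iexp (u \<bullet> x)) =
        (\<Prod>i=1..n1 n. CLINT x|P0. iexp (s * (sqrt (real n) / real (n1 n)) * k1 x + t * c (n1 n) i * g1 x)) *
        (\<Prod>j=1..n2 n. CLINT y|Q0. iexp (s * (sqrt (real n) / real (n2 n)) * k2 y + t * c' (n2 n) j * g2 y))"
      for n
    proof -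
      \<comment> \<open>Regrouping \<open>s * T n + t * X n\<close> by observation makes each
        summand a function of one coordinate, so the factorization over independent coordinates
        applies.\<close>
      have eq: "u \<bullet> ?Z n \<omega> =
          (\<Sum>i=1..n1 n. s * (sqrt (real n) / real (n1 n)) * k1 (fst \<omega> i) + t * c (n1 n) i * g1 (fst \<omega> i)) +
          (\<Sum>j=1..n2 n. s * (sqrt (real n) / real (n2 n)) * k2 (snd \<omega> j) + t * c' (n2 n) j * g2 (snd \<omega> j))"
        for \<omega>
        using T[of n "fst \<omega>" "snd \<omega>"] X[of n "fst \<omega>" "snd \<omega>"]
        by (simp add: inner_vec_def sum_2 s_def t_def sum.distrib sum_distrib_left algebra_simps)
      have "(CLINT x|distr (?N n) borel (?Z n). iexp (u \<bullet> x)) = (CLINT \<omega>|?N n. iexp (u \<bullet> ?Z n \<omega>))"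
        by (rule integral_distr[OF Z_meas]) simp
      then show ?thesis
        unfolding eq by (subst (asm) integral_iexp_sum_pair_PiM[OF P0 Q0]) auto
    qed
    moreover have "(CLINT x|mv_normal (vector [0, 0]) ?\<Sigma>. iexp (u \<bullet> x)) =
        complex_of_real (exp (- ((s\<^sup>2 / (1 - d)) * (\<integral>x. (k1 x)\<^sup>2 \<partial>P0)
          + 2 * (s * t * a1 / sqrt (1 - d)) * (\<integral>x. k1 x * g1 x \<partial>P0) + t\<^sup>2 * c1\<^sup>2 * (\<integral>x. (g1 x)\<^sup>2 \<partial>P0)) / 2)) *
        complex_of_real (exp (- ((s\<^sup>2 / d) * (\<integral>y. (k2 y)\<^sup>2 \<partial>Q0)
          + 2 * (s * t * a2 / sqrt d) * (\<integral>y. k2 y * g2 y \<partial>Q0) + t\<^sup>2 * c2\<^sup>2 * (\<integral>y. (g2 y)\<^sup>2 \<partial>Q0)) / 2))"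
    proof -
      \<comment> \<open>The quadratic form separates by sample, which splits the normal
        characteristic function into the two limits supplied by \<open>sample1\<close> and
        \<open>sample2\<close>.\<close>
      have "u \<bullet> (?\<Sigma> *v u) = (s\<^sup>2 / (1 - d)) * (\<integral>x. (k1 x)\<^sup>2 \<partial>P0)
          + 2 * (s * t * a1 / sqrt (1 - d)) * (\<integral>x. k1 x * g1 x \<partial>P0) + t\<^sup>2 * c1\<^sup>2 * (\<integral>x. (g1 x)\<^sup>2 \<partial>P0)
          + ((s\<^sup>2 / d) * (\<integral>y. (k2 y)\<^sup>2 \<partial>Q0)
          + 2 * (s * t * a2 / sqrt d) * (\<integral>y. k2 y * g2 y \<partial>Q0) + t\<^sup>2 * c2\<^sup>2 * (\<integral>y. (g2 y)\<^sup>2 \<partial>Q0))"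
        by (simp add: inner_vec_def sum_2 matrix_vector_mult_def s_def[symmetric] t_def[symmetric]
            p_def q_def r_def power2_eq_square algebra_simps)
      moreover have "u \<bullet> (vector [0, 0] :: real^2) = 0" by (simp add: inner_vec_def sum_2)
      ultimately show ?thesis
        unfolding mv_normal_characteristic_function[OF root] of_real_mult[symmetric] exp_add[symmetric]
        by (simp add: add_divide_distrib)
    qed
    ultimately show "(\<lambda>n. CLINT x|distr (?N n) borel (?Z n). iexp (u \<bullet> x))
        \<longlonglongrightarrow> (CLINT x|mv_normal (vector [0, 0]) ?\<Sigma>. iexp (u \<bullet> x))"
      using tendsto_mult[OF sample1(1)[of s t] sample2(1)[of s t]] by simp
  qed (simp_all add: prob_space_mv_normal)
  then show ?thesis by (simp only: Let_def p_def q_def r_def)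
qed

end
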